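(* Let $\mathcal X$ be a finite set, let $\rho\in\mathcal S(\mathcal X)$ be a probability density function on $\mathcal X$, and let $S\subseteq\mathcal S(\mathcal X)$ be non-empty, with closed convex hull $\overline{\mathrm{co}}(S)$. Assume that $D(\rho\|S)<D_\infty^*(\rho\|S)$. Then for any $r>0$, \begin{align*} H_r^*(\rho\|\overline{\mathrm{co}}(S))&=\sup_{\sigma\in\overline{\mathrm{co}}(S)}\mathrm{sc}_r(\rho\|\sigma)\\ &\ge\mathrm{sc}_r^{\mathrm{adv}}(\rho\|\overline{\mathrm{co}}(S))\ge\mathrm{sc}_r^{\mathrm{adv}}(\rho\|S)\\ &\ge\mathrm{sc}_r^{\mathrm{av}}(\rho\|S)=\mathrm{sc}_r^{\mathrm{av}}(\rho\|\overline{\mathrm{co}}(S))\\ &\ge\mathrm{sc}_r(\rho\|\overline{\mathrm{co}}(S))\ge\mathrm{sc}_r^{\{1\}}(\rho\|\overline{\mathrm{co}}(S))\\ &\ge\sup_{\sigma\in\overline{\mathrm{co}}(S)}\mathrm{sc}_r(\rho\|\sigma), \end{align*} and hence all these inequalities hold as equalities.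
   Context: $\mathcal S(\mathcal X)$ is the set of probability density functions on $\mathcal X$; $\log$ is natural, $-\log0=+\infty$. Divergences: $D(\rho\|\sigma)=\sum_x\rho(x)\log\frac{\rho(x)}{\sigma(x)}$ if $\operatorname{supp}\rho\subseteq\operatorname{supp}\sigma$, else $+\infty$; for $\alpha>1$, $D_\alpha(\rho\|\sigma)=\frac1{\alpha-1}\log\sum_x\rho(x)^\alpha\sigma(x)^{1-\alpha}$ (sum over $\operatorname{supp}\rho$) if $\operatorname{supp}\rho\subseteq\operatorname{supp}\sigma$, else $+\infty$; $D_\infty^*(\rho\|\sigma)=\inf\{\lambda:\rho\le e^\lambda\sigma\}$. Hoeffding anti-divergence: $H_r^*(\rho\|\sigma)=\max\big\{0,\sup_{\alpha>1}\frac{\alpha-1}\alpha[r-D_\alpha(\rho\|\sigma)]\big\}$. For sets: $D(\rho\|A)=\inf_{\sigma\in A}D(\rho\|\sigma)$, $D_\infty^*(\rho\|A)=\inf_{\sigma\in A}D_\infty^*(\rho\|\sigma)$, $H_r^*(\rho\|A)=\sup_{\sigma\in A}H_r^*(\rho\|\sigma)$. Alternative hypotheses on $n$ samples for $A\subseteq\mathcal S(\mathcal X)$: i.i.d. $A^{\otimes n}=\{\sigma^{\otimes n}:\sigma\in A\}$; arbitrarily varying $A^{\otimes n}_{\mathrm{av}}=\{\sigma_1\otimes\dots\otimes\sigma_n:\sigma_k\in A\}$; adversarial $A^{(n)}_{\mathrm{adv}}$: all $\sigma\in\mathcal S(\mathcal X^n)$ whose first marginal is in $A$ and such that for all $k=1,\dots,n-1$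 and $(x_1,\dots,x_k)\in\mathcal X^k$ (of positive probability, so that it is defined) the conditional distribution $\sigma_{k+1}(\cdot|x_1\dots x_k)$ of the $(k+1)$-th coordinate given the first $k$ is in $A$. A test is $T_n:\mathcal X^n\to[0,1]$, $\omega(T_n)=\sum_{\underline x}\omega(\underline x)T_n(\underline x)$. The null hypothesis is $(\rho^{\otimes n})_n$. For an alternative hypothesis $(S_n)_n$, $S_n\subseteq\mathcal S(\mathcal X^n)$, the strong converse exponent is $\inf\{\limsup_n-\frac1n\log\rho^{\otimes n}(T_n):\ \liminf_n-\frac1n\log\sup_{\sigma\in S_n}\sigma(T_n)\ge r\}$, the infimum being over test sequences satisfying the condition. It is denoted $\mathrm{sc}_r(\rho\|A)$, $\mathrm{sc}_r^{\mathrm{av}}(\rho\|A)$, $\mathrm{sc}_r^{\mathrm{adv}}(\rho\|A)$ for $S_n=A^{\otimes n},A^{\otimes n}_{\mathrm{av}},A^{(n)}_{\mathrm{adv}}$, respectively; $\mathrm{sc}_r(\rho\|\sigma)=\mathrm{sc}_r(\rho\|\{\sigma\})$. The relaxed exponent $\mathrm{sc}_r^{\{1\}}(\rho\|A)$ is the infimum of $\limsup_n-\frac1n\log\rho^{\otimes n}(T_n)$ over test sequences with $\liminf_n-\frac1n\log\sigma^{\otimes n}(T_n)\ge r$ for every $\sigma\in A$. *)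

theory Defs
  imports "HOL-Analysis.Analysis"
begin

text \<open>
  A finite alphabet is a type \<open>'x::finite\<close>. A function on the alphabet is a vector in
  \<open>real ^ 'x\<close>, so that \<^const>\<open>hull\<close> and \<^const>\<open>closure\<close> apply to sets of densities. Since \<open>n\<close>
  varies, a function on the \<open>n\<close>-th power of the alphabet is a function on \<open>'x list\<close> of which
  only the values on lists of length \<open>n\<close> matter; densities are normalised to \<open>0\<close> elsewhere.
  The length \<open>n = 0\<close> is harmless, as only limits for large \<open>n\<close> are used.
\<close>

definition densities :: "(real ^ 'x::finite) set" where
  "densities = {p. (\<forall>x. 0 \<le> p $ x) \<and> (\<Sum>x\<in>UNIV. p $ x) = 1}"

definition words :: "nat \<Rightarrow> 'x list set" where
  "words n = {xs. length xs = n}"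

definition word_densities :: "nat \<Rightarrow> ('x::finite list \<Rightarrow> real) set" where
  "word_densities n =
     {\<omega>. (\<forall>xs\<in>words n. 0 \<le> \<omega> xs) \<and> (\<forall>xs. xs \<notin> words n \<longrightarrow> \<omega> xs = 0) \<and>
         (\<Sum>xs\<in>words n. \<omega> xs) = 1}"


definition supp :: "real ^ 'x::finite \<Rightarrow> 'x set" where
  "supp p = {x. p $ x \<noteq> 0}"

text \<open>Below, terms with \<open>p $ x = 0\<close> vanish, which is the convention \<open>0 log 0 = 0\<close>.\<close>

definition rel_entropy :: "real ^ 'x::finite \<Rightarrow> real ^ 'x \<Rightarrow> ereal" where
  "rel_entropy p q =
     (if supp p \<subseteq> supp q then ereal (\<Sum>x\<in>UNIV. p $ x * ln (p $ x / q $ x)) else \<infinity>)"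

definition renyi_div :: "real \<Rightarrow> real ^ 'x::finite \<Rightarrow> real ^ 'x \<Rightarrow> ereal" where
  "renyi_div \<alpha> p q =
     (if supp p \<subseteq> supp q
      then ereal (1 / (\<alpha> - 1) * ln (\<Sum>x\<in>supp p. (p $ x) powr \<alpha> * (q $ x) powr (1 - \<alpha>)))
      else \<infinity>)"

definition max_div :: "real ^ 'x::finite \<Rightarrow> real ^ 'x \<Rightarrow> ereal" where
  "max_div p q = Inf {ereal l | l. \<forall>x. p $ x \<le> exp l * q $ x}"

definition hoeffding_anti :: "real \<Rightarrow> real ^ 'x::finite \<Rightarrow> real ^ 'x \<Rightarrow> ereal" where
  "hoeffding_anti r p q =
     max 0 (SUP \<alpha>\<in>{1<..}. ereal ((\<alpha> - 1) / \<alpha>) * (ereal r - renyi_div \<alpha> p q))"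

definition rel_entropy_set :: "real ^ 'x::finite \<Rightarrow> (real ^ 'x) set \<Rightarrow> ereal" where
  "rel_entropy_set p A = (INF q\<in>A. rel_entropy p q)"

definition max_div_set :: "real ^ 'x::finite \<Rightarrow> (real ^ 'x) set \<Rightarrow> ereal" where
  "max_div_set p A = (INF q\<in>A. max_div p q)"

definition hoeffding_anti_set :: "real \<Rightarrow> real ^ 'x::finite \<Rightarrow> (real ^ 'x) set \<Rightarrow> ereal" where
  "hoeffding_anti_set r p A = (SUP q\<in>A. hoeffding_anti r p q)"


definition prod_density :: "nat \<Rightarrow> (nat \<Rightarrow> real ^ 'x::finite) \<Rightarrow> 'x list \<Rightarrow> real" where
  "prod_density n q xs = (if xs \<in> words n then \<Prod>i<n. q i $ (xs ! i) else 0)"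

definition iid_density :: "nat \<Rightarrow> real ^ 'x::finite \<Rightarrow> 'x list \<Rightarrow> real" where
  "iid_density n q = prod_density n (\<lambda>_. q)"

definition iid_hyp :: "(real ^ 'x::finite) set \<Rightarrow> nat \<Rightarrow> ('x list \<Rightarrow> real) set" where
  "iid_hyp A n = {iid_density n q | q. q \<in> A}"

definition av_hyp :: "(real ^ 'x::finite) set \<Rightarrow> nat \<Rightarrow> ('x list \<Rightarrow> real) set" where
  "av_hyp A n = {prod_density n q | q. \<forall>i<n. q i \<in> A}"

definition prefix_prob :: "nat \<Rightarrow> ('x::finite list \<Rightarrow> real) \<Rightarrow> 'x list \<Rightarrow> real" where
  "prefix_prob n \<omega> xs = (\<Sum>ys\<in>{ys \<in> words n. take (length xs) ys = xs}. \<omega> ys)"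

definition first_marginal :: "nat \<Rightarrow> ('x::finite list \<Rightarrow> real) \<Rightarrow> real ^ 'x" where
  "first_marginal n \<omega> = (\<chi> a. prefix_prob n \<omega> [a])"

definition next_given :: "nat \<Rightarrow> ('x::finite list \<Rightarrow> real) \<Rightarrow> 'x list \<Rightarrow> real ^ 'x" where
  "next_given n \<omega> xs = (\<chi> a. prefix_prob n \<omega> (xs @ [a]) / prefix_prob n \<omega> xs)"

definition adv_hyp :: "(real ^ 'x::finite) set \<Rightarrow> nat \<Rightarrow> ('x list \<Rightarrow> real) set" where
  "adv_hyp A n =
     {\<omega> \<in> word_densities n. first_marginal n \<omega> \<in> A \<and>
        (\<forall>k\<in>{1..<n}. \<forall>xs\<in>words k. 0 < prefix_prob n \<omega> xs \<longrightarrow> next_given n \<omega> xs \<in> A)}"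


definition is_test :: "nat \<Rightarrow> ('x list \<Rightarrow> real) \<Rightarrow> bool" where
  "is_test n T \<longleftrightarrow> (\<forall>xs\<in>words n. 0 \<le> T xs \<and> T xs \<le> 1)"

definition test_val :: "nat \<Rightarrow> ('x::finite list \<Rightarrow> real) \<Rightarrow> ('x list \<Rightarrow> real) \<Rightarrow> real" where
  "test_val n \<omega> T = (\<Sum>xs\<in>words n. \<omega> xs * T xs)"

text \<open>This is \<open>- (1/n) log t\<close> for \<open>t \<ge> 0\<close>, with \<open>- log 0 = \<infinity>\<close>.\<close>

definition err_rate :: "nat \<Rightarrow> real \<Rightarrow> ereal" where
  "err_rate n t = (if t = 0 then \<infinity> else ereal (- (1 / real n) * ln t))"

text \<open>The supremum over \<open>H n\<close> is one of real numbers in \<open>[0, 1]\<close>.\<close>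

definition sc_exp ::
    "real \<Rightarrow> real ^ 'x::finite \<Rightarrow> (nat \<Rightarrow> ('x list \<Rightarrow> real) set) \<Rightarrow> ereal" where
  "sc_exp r p H =
     Inf {limsup (\<lambda>n. err_rate n (test_val n (iid_density n p) (T n))) | T.
            (\<forall>n. is_test n (T n)) \<and>
            liminf (\<lambda>n. err_rate n (SUP \<omega>\<in>H n. test_val n \<omega> (T n))) \<ge> ereal r}"

definition sc_iid :: "real \<Rightarrow> real ^ 'x::finite \<Rightarrow> (real ^ 'x) set \<Rightarrow> ereal" where
  "sc_iid r p A = sc_exp r p (iid_hyp A)"

definition sc_av :: "real \<Rightarrow> real ^ 'x::finite \<Rightarrow> (real ^ 'x) set \<Rightarrow> ereal" where
  "sc_av r p A = sc_exp r p (av_hyp A)"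

definition sc_adv :: "real \<Rightarrow> real ^ 'x::finite \<Rightarrow> (real ^ 'x) set \<Rightarrow> ereal" where
  "sc_adv r p A = sc_exp r p (adv_hyp A)"

definition sc_simple :: "real \<Rightarrow> real ^ 'x::finite \<Rightarrow> real ^ 'x \<Rightarrow> ereal" where
  "sc_simple r p q = sc_iid r p {q}"

definition sc_relaxed :: "real \<Rightarrow> real ^ 'x::finite \<Rightarrow> (real ^ 'x) set \<Rightarrow> ereal" where
  "sc_relaxed r p A =
     Inf {limsup (\<lambda>n. err_rate n (test_val n (iid_density n p) (T n))) | T.
            (\<forall>n. is_test n (T n)) \<and>
            (\<forall>q\<in>A. liminf (\<lambda>n. err_rate n (test_val n (iid_density n q) (T n))) \<ge> ereal r)}"

end

theory Submission
  imports Defs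
begin

text \<open>
  The inequalities between the exponents are inclusions of hypotheses, and
  \<open>H\<^sub>r\<^sup>*(\<rho>\<parallel>\<sigma>) \<le> sc\<^sub>r(\<rho>\<parallel>\<sigma>)\<close> is Hoelder's inequality, so everything reduces to
  \<open>sc\<^sub>r\<^sup>a\<^sup>d\<^sup>v(\<rho>\<parallel>C) \<le> H\<^sub>r\<^sup>*(\<rho>\<parallel>C)\<close>. Maximise
  \<open>G \<alpha> \<sigma> = (\<alpha> - 1) / \<alpha> * (r - D\<^sub>\<alpha>(\<rho>\<parallel>\<sigma>))\<close> jointly over \<open>\<alpha>\<close> and \<open>\<sigma> \<in> C\<close>, and let \<open>\<tau>\<close> be
  proportional to \<open>\<rho>\<^sup>\<alpha> \<sigma>\<^sup>1\<^sup>-\<^sup>\<alpha>\<close> at the maximiser. Stationarity in \<open>\<sigma>\<close> says that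
  \<open>(\<Sum>x. q x * \<tau> x / \<sigma> x) \<le> 1\<close> for all \<open>q \<in> C\<close>, so that the product of the likelihood ratios
  \<open>\<tau> / \<sigma>\<close> is a supermartingale under every adversarial alternative and the test
  \<open>min 1 (exp (- n r) * \<Prod>i. \<tau> (x i) / \<sigma> (x i))\<close> has type II error at most \<open>exp (- n r)\<close>.
  Stationarity in \<open>\<alpha>\<close> says that \<open>D(\<tau>\<parallel>\<sigma>) = r\<close>, hence \<open>D(\<tau>\<parallel>\<rho>) = G \<alpha> \<sigma>\<close>; by Jensen's
  inequality under \<open>\<tau>\<^sup>n\<close> and a variance bound, the test succeeds under \<open>\<rho>\<^sup>n\<close> with exponent at
  most \<open>D(\<tau>\<parallel>\<rho>) + max 0 (r - D(\<tau>\<parallel>\<sigma>))\<close>.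
\<close>

subsection \<open>Words and product densities\<close>

lemma finite_words [simp]: "finite (words n :: 'x::finite list set)"
  using finite_lists_length_eq[of "UNIV :: 'x set" n] by (simp add: words_def)

lemma words_0 [simp]: "words 0 = {[]}"
  by (auto simp: words_def)

text \<open>Words grow at the end rather than at the front, because an adversary fixes the law of
  the next letter from the prefix already seen.\<close>

lemma sum_words_Suc:
  fixes f :: "'x::finite list \<Rightarrow> 'b::comm_monoid_add"
  shows "(\<Sum>xs\<in>words (Suc n). f xs) = (\<Sum>xs\<in>words n. \<Sum>a\<in>UNIV. f (xs @ [a]))"
proof -
  have eq: "words (Suc n) = (\<lambda>(xs, a::'x). xs @ [a]) ` (words n \<times> UNIV)"
  proof (intro equalityI subsetI)
    fix xs :: "'x list" assume "xs \<in> words (Suc n)"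
    then have "xs \<noteq> []" "butlast xs \<in> words n"
      by (auto simp: words_def)
    then have "xs = butlast xs @ [last xs]" "butlast xs \<in> words n"
      by auto
    then show "xs \<in> (\<lambda>(xs, a). xs @ [a]) ` (words n \<times> UNIV)"
      by (intro image_eqI[of _ _ "(butlast xs, last xs)"]) simp_all
  qed (auto simp: words_def)
  have inj: "inj_on (\<lambda>(xs, a::'x). xs @ [a]) (words n \<times> UNIV)"
    by (auto simp: inj_on_def)
  show ?thesis
    unfolding eq sum.reindex[OF inj] by (simp add: sum.cartesian_product case_prod_unfold)
qed

lemma prod_density_Nil [simp]: "prod_density 0 q [] = 1"
  by (simp add: prod_density_def)

lemma prod_density_snoc:
  assumes "xs \<in> words n"
  shows "prod_density (Suc n) q (xs @ [a]) = prod_density n q xs * q n $ a"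
  using assms by (simp add: prod_density_def words_def nth_append)

lemma iid_density_Nil [simp]: "iid_density 0 q [] = 1"
  by (simp add: iid_density_def)

lemma iid_density_snoc:
  "xs \<in> words n \<Longrightarrow> iid_density (Suc n) q (xs @ [a]) = iid_density n q xs * q $ a"
  by (simp add: iid_density_def prod_density_snoc)

lemma iid_density_eq_prod_list:
  "xs \<in> words n \<Longrightarrow> iid_density n q xs = prod_list (map (\<lambda>a. q $ a) xs)"
  by (simp add: iid_density_def prod_density_def words_def prod.list_conv_set_nth
      atLeast0LessThan)

lemma prod_density_nonneg: "(\<And>i. i < n \<Longrightarrow> q i \<in> densities) \<Longrightarrow> 0 \<le> prod_density n q xs"
  by (auto simp: prod_density_def densities_def intro!: prod_nonneg)

lemma sum_prod_density:
  assumes "\<And>i. i < n \<Longrightarrow> q i \<in> densities"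
  shows "(\<Sum>xs\<in>words n. prod_density n q xs) = 1"
  using assms
  by (induction n)
    (simp_all add: sum_words_Suc prod_density_snoc densities_def flip: sum_distrib_left)

lemma prod_density_outside: "xs \<notin> words n \<Longrightarrow> prod_density n q xs = 0"
  by (simp add: prod_density_def)

lemma prod_density_in_word_densities:
  "(\<And>i. i < n \<Longrightarrow> q i \<in> densities) \<Longrightarrow> prod_density n q \<in> word_densities n"
  using prod_density_nonneg[of n q] sum_prod_density[of n q]
  by (auto simp: word_densities_def prod_density_outside)

text \<open>The distributive law. It makes the sum defining the Renyi divergence multiplicative in
  the number of samples.\<close>

lemma sum_words_prod_list:
  "(\<Sum>xs\<in>words n. prod_list (map f xs)) = (\<Sum>a\<in>UNIV. f (a::'x::finite) :: real) ^ n"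
  by (induction n) (simp_all add: sum_words_Suc mult.commute flip: sum_distrib_left sum_distrib_right)

section \<open>First and second moments of additive statistics under an i.i.d. density\<close>

lemma sum_iid_sum_list:
  assumes "q \<in> densities"
  shows "(\<Sum>xs\<in>words n. iid_density n q xs * sum_list (map g xs)) = n * (\<Sum>a\<in>UNIV. q $ a * g a)"
proof (induction n)
  case (Suc n)
  have 1: "(\<Sum>a\<in>UNIV. q $ a) = 1" using assms by (simp add: densities_def)
  have 2: "(\<Sum>xs\<in>words n. iid_density n q xs) = 1"
    unfolding iid_density_def using assms by (intro sum_prod_density)
  have "(\<Sum>xs\<in>words (Suc n). iid_density (Suc n) q xs * sum_list (map g xs))
     = (\<Sum>xs\<in>words n. \<Sum>a\<in>UNIV. q $ a * (iid_density n q xs * sum_list (map g xs))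
          + iid_density n q xs * (q $ a * g a))"
    by (simp add: sum_words_Suc iid_density_snoc algebra_simps)
  also have "\<dots> = (\<Sum>xs\<in>words n. iid_density n q xs * sum_list (map g xs)
       + iid_density n q xs * (\<Sum>a\<in>UNIV. q $ a * g a))"
    by (simp add: sum.distrib 1 flip: sum_distrib_left sum_distrib_right)
  also have "\<dots> = Suc n * (\<Sum>a\<in>UNIV. q $ a * g a)"
    by (simp add: sum.distrib 2 Suc algebra_simps flip: sum_distrib_left sum_distrib_right)
  finally show ?case .
qed simp

text \<open>Variances of independent letters add up: the cross terms vanish because \<open>g\<close>
  is centred.\<close>

lemma sum_iid_sum_list_squared:
  assumes "q \<in> densities" and mean: "(\<Sum>a\<in>UNIV. q $ a * g a) = 0"
  shows "(\<Sum>xs\<in>words n. iid_density n q xs * (sum_list (map g xs))\<^sup>2)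
    = n * (\<Sum>a\<in>UNIV. q $ a * (g a)\<^sup>2)"
proof (induction n)
  case (Suc n)
  have 1: "(\<Sum>a\<in>UNIV. q $ a) = 1" using assms by (simp add: densities_def)
  have 2: "(\<Sum>xs\<in>words n. iid_density n q xs) = 1"
    unfolding iid_density_def using assms by (intro sum_prod_density)
  have "(\<Sum>xs\<in>words (Suc n). iid_density (Suc n) q xs * (sum_list (map g xs))\<^sup>2)
     = (\<Sum>xs\<in>words n. \<Sum>a\<in>UNIV. q $ a * (iid_density n q xs * (sum_list (map g xs))\<^sup>2)
          + 2 * iid_density n q xs * sum_list (map g xs) * (q $ a * g a)
          + iid_density n q xs * (q $ a * (g a)\<^sup>2))"
    by (simp add: sum_words_Suc iid_density_snoc algebra_simps power2_eq_square)
  also have "\<dots> = (\<Sum>xs\<in>words n. iid_density n q xs * (sum_list (map g xs))\<^sup>2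
       + iid_density n q xs * (\<Sum>a\<in>UNIV. q $ a * (g a)\<^sup>2))"
    by (simp add: sum.distrib 1 mean flip: sum_distrib_left sum_distrib_right)
  also have "\<dots> = Suc n * (\<Sum>a\<in>UNIV. q $ a * (g a)\<^sup>2)"
    by (simp add: sum.distrib 2 Suc algebra_simps flip: sum_distrib_left sum_distrib_right)
  finally show ?case .
qed simp

section \<open>Prefix probabilities and adversarial alternatives\<close>

lemma prefix_prob_nonneg: "\<omega> \<in> word_densities n \<Longrightarrow> 0 \<le> prefix_prob n \<omega> xs"
  by (auto simp: prefix_prob_def word_densities_def intro!: sum_nonneg)

lemma prefix_prob_Nil: "\<omega> \<in> word_densities n \<Longrightarrow> prefix_prob n \<omega> [] = 1"
  by (simp add: prefix_prob_def word_densities_def)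

lemma prefix_prob_full:
  assumes "xs \<in> words n" shows "prefix_prob n \<omega> xs = \<omega> xs"
proof -
  have "{ys \<in> words n. take (length xs) ys = xs} = {xs}"
    using assms by (auto simp: words_def)
  then show ?thesis by (simp add: prefix_prob_def)
qed

lemma prefix_prob_eq_sum_snoc:
  assumes "xs \<in> words k" and "k < n"
  shows "prefix_prob n \<omega> xs = (\<Sum>a\<in>UNIV. prefix_prob n \<omega> (xs @ [a]))"
proof -
  let ?B = "{ys \<in> words n. take k ys = xs}"
  have "prefix_prob n \<omega> xs = sum \<omega> ?B"
    using assms by (simp add: prefix_prob_def words_def)
  also have "\<dots> = (\<Sum>a\<in>UNIV. sum \<omega> {ys \<in> ?B. ys ! k = a})"
    by (rule sum.group[symmetric]) auto
  also have "\<dots> = (\<Sum>a\<in>UNIV. prefix_prob n \<omega> (xs @ [a]))"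
    unfolding prefix_prob_def using assms
    by (intro sum.cong refl arg_cong[of _ _ "sum \<omega>"]) (auto simp: words_def take_Suc_conv_app_nth)
  finally show ?thesis .
qed

text \<open>Downward induction from the full word: each step sums out one letter, whose factor has
  total mass 1.\<close>

lemma prefix_prob_prod_density:
  assumes "k \<le> n" and "\<And>i. i < n \<Longrightarrow> q i \<in> densities" and "xs \<in> words k"
  shows "prefix_prob n (prod_density n q) xs = prod_density k q xs"
  using assms(1,3)
proof (induction k arbitrary: xs rule: inc_induct)
  case base
  then show ?case by (rule prefix_prob_full)
next
  case (step k)
  then have "prefix_prob n (prod_density n q) xs
      = (\<Sum>a\<in>UNIV. prefix_prob n (prod_density n q) (xs @ [a]))"
    by (intro prefix_prob_eq_sum_snoc) auto
  also have "\<dots> = (\<Sum>a\<in>UNIV. prod_density k q xs * q k $ a)"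
    using step by (intro sum.cong refl) (simp add: words_def prod_density_snoc)
  also have "\<dots> = prod_density k q xs"
    using step assms(2)[of k] by (simp add: densities_def flip: sum_distrib_left)
  finally show ?case .
qed

text \<open>Under a product density the next letter ignores the past, so its conditional law is the
  corresponding factor. For \<open>n = 0\<close> the first marginal would be the zero vector, hence
  \<open>0 < n\<close>.\<close>

lemma av_hyp_subset_adv_hyp:
  assumes "A \<subseteq> densities" and "0 < n"
  shows "av_hyp A n \<subseteq> adv_hyp A n"
proof
  fix \<omega> assume "\<omega> \<in> av_hyp A n"
  then obtain q where \<omega>: "\<omega> = prod_density n q" and q: "\<And>i. i < n \<Longrightarrow> q i \<in> A"
    by (auto simp: av_hyp_def)
  have d: "\<And>i. i < n \<Longrightarrow> q i \<in> densities" using q assms by auto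
  have "first_marginal n \<omega> = q 0"
    using prefix_prob_prod_density[of 1 n q] d assms(2)
    by (simp add: first_marginal_def \<omega> vec_eq_iff words_def prod_density_def)
  moreover have "next_given n \<omega> xs = q k"
    if "k < n" "xs \<in> words k" "0 < prefix_prob n \<omega> xs" for k xs
  proof -
    have "prefix_prob n \<omega> (xs @ [a]) = prefix_prob n \<omega> xs * q k $ a" for a
      using that prefix_prob_prod_density[of k n q xs] prefix_prob_prod_density[of "Suc k" n q "xs @ [a]"] d
      by (simp add: \<omega> prod_density_snoc words_def)
    then show ?thesis using that(3) by (simp add: next_given_def vec_eq_iff)
  qed
  ultimately show "\<omega> \<in> adv_hyp A n"
    using q assms(2) prod_density_in_word_densities[OF d] by (auto simp: adv_hyp_def \<omega>)
qed

text \<open>A per-letter bet that is fair or worse against every member of \<open>A\<close> stays so against an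
  adversary: the wealth is a supermartingale.\<close>

lemma adv_hyp_evalue:
  assumes \<omega>: "\<omega> \<in> adv_hyp A n"
    and e: "\<And>a. 0 \<le> e a" and fair: "\<And>q. q \<in> A \<Longrightarrow> (\<Sum>a\<in>UNIV. q $ a * e a) \<le> 1"
  shows "(\<Sum>xs\<in>words n. \<omega> xs * prod_list (map e xs)) \<le> 1"
proof -
  have wd: "\<omega> \<in> word_densities n" using \<omega> by (simp add: adv_hyp_def)
  \<comment> \<open>The first letter is governed by the first marginal, later letters by
    \<open>next_given\<close>. A prefix of probability 0 has no conditional law, but all its
    extensions have probability 0 as well.\<close>
  have one_step: "(\<Sum>a\<in>UNIV. prefix_prob n \<omega> (xs @ [a]) * e a) \<le> prefix_prob n \<omega> xs"
    if k: "k < n" "xs \<in> words k" for k xs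
  proof (cases "k = 0")
    case True
    then show ?thesis
      using \<omega> k fair[of "first_marginal n \<omega>"] prefix_prob_Nil[OF wd]
      by (simp add: adv_hyp_def first_marginal_def)
  next
    case False
    show ?thesis
    proof (cases "prefix_prob n \<omega> xs = 0")
      case True
      then have "\<forall>a\<in>UNIV. prefix_prob n \<omega> (xs @ [a]) = 0"
        using prefix_prob_eq_sum_snoc[OF k(2,1), of \<omega>] prefix_prob_nonneg[OF wd]
        by (subst sum_nonneg_eq_0_iff[symmetric]) auto
      then show ?thesis using True by simp
    next
      case nz: False
      then have pos: "0 < prefix_prob n \<omega> xs"
        using prefix_prob_nonneg[OF wd, of xs] by simp
      then have "next_given n \<omega> xs \<in> A"
        using \<omega> k False by (auto simp: adv_hyp_def)
      from fair[OF this] have "(\<Sum>a\<in>UNIV. prefix_prob n \<omega> (xs @ [a]) * e a) / prefix_prob n \<omega> xs \<le> 1"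
        by (simp add: next_given_def sum_divide_distrib)
      then show ?thesis using pos by (simp add: divide_le_eq)
    qed
  qed
  have "(\<Sum>xs\<in>words k. prefix_prob n \<omega> xs * prod_list (map e xs)) \<le> 1" if "k \<le> n" for k
    using that
  proof (induction k)
    case 0
    then show ?case using prefix_prob_Nil[OF wd] by simp
  next
    case (Suc k)
    have "(\<Sum>xs\<in>words (Suc k). prefix_prob n \<omega> xs * prod_list (map e xs))
      = (\<Sum>xs\<in>words k. (\<Sum>a\<in>UNIV. prefix_prob n \<omega> (xs @ [a]) * e a) * prod_list (map e xs))"
      by (simp add: sum_words_Suc sum_distrib_left sum_distrib_right mult_ac)
    also have "\<dots> \<le> (\<Sum>xs\<in>words k. prefix_prob n \<omega> xs * prod_list (map e xs))"
      using one_step[of k] Suc.prems e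
      by (intro sum_mono mult_right_mono prod_list_nonneg) auto
    also have "\<dots> \<le> 1" using Suc by simp
    finally show ?case .
  qed
  from this[of n] show ?thesis by (simp add: prefix_prob_full)
qed

subsection \<open>Tests from likelihood ratios\<close>

lemma test_val_nonneg:
  assumes "\<And>xs. xs \<in> words n \<Longrightarrow> 0 \<le> \<omega> xs" "is_test n T"
  shows "0 \<le> test_val n \<omega> T"
  using assms by (auto simp: test_val_def is_test_def intro!: sum_nonneg)

lemma test_val_le_1:
  assumes "\<omega> \<in> word_densities n" "is_test n T"
  shows "test_val n \<omega> T \<le> 1"
proof -
  have "test_val n \<omega> T \<le> (\<Sum>xs\<in>words n. \<omega> xs * 1)"
    unfolding test_val_def using assms
    by (intro sum_mono mult_left_mono) (auto simp: word_densities_def is_test_def)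
  then show ?thesis using assms by (simp add: word_densities_def)
qed

lemma err_rate_antimono:
  assumes "0 \<le> s" "s \<le> t"
  shows "err_rate n t \<le> err_rate n s"
proof (cases "s = 0")
  case False
  then have "ln s \<le> ln t" using assms by simp
  then show ?thesis
    using False assms by (auto simp: err_rate_def intro!: divide_right_mono)
qed (simp add: err_rate_def)

lemma err_rate_exp: "0 < n \<Longrightarrow> err_rate n (exp (- real n * x)) = ereal x"
  by (simp add: err_rate_def)

lemma err_rate_1 [simp]: "err_rate n 1 = 0"
  by (simp add: err_rate_def)

lemma adv_hyp_nonempty:
  assumes "A \<subseteq> densities" "A \<noteq> {}" "0 < n"
  shows "adv_hyp A n \<noteq> {}"
proof -
  obtain q where "q \<in> A" using assms by auto
  then have "prod_density n (\<lambda>_. q) \<in> av_hyp A n" by (auto simp: av_hyp_def)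
  then show ?thesis using av_hyp_subset_adv_hyp assms by blast
qed

text \<open>The suprema over alternatives are taken in the reals, so comparing them requires an
  upper bound.\<close>

lemma bdd_above_test_val:
  "H \<subseteq> word_densities n \<Longrightarrow> is_test n T \<Longrightarrow> bdd_above ((\<lambda>\<omega>. test_val n \<omega> T) ` H)"
  using test_val_le_1 by (fastforce simp: bdd_above_def)

lemma SUP_test_val_nonneg:
  assumes "H \<subseteq> word_densities n" "is_test n T" "H \<noteq> {}"
  shows "0 \<le> (SUP \<omega>\<in>H. test_val n \<omega> T)"
proof -
  obtain \<omega> where \<omega>: "\<omega> \<in> H" using assms by auto
  then have "0 \<le> test_val n \<omega> T"
    using assms by (intro test_val_nonneg) (auto simp: word_densities_def)
  also have "\<dots> \<le> (SUP \<omega>\<in>H. test_val n \<omega> T)"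
    using \<omega> bdd_above_test_val[OF assms(1,2)] by (rule cSUP_upper)
  finally show ?thesis .
qed

text \<open>Jensen's inequality; it turns the mean of a log-likelihood into a lower bound on a
  probability.\<close>

lemma exp_mean_le_mean_exp:
  fixes z :: "'a \<Rightarrow> real"
  assumes "finite I" "\<And>i. i \<in> I \<Longrightarrow> 0 \<le> w i" "(\<Sum>i\<in>I. w i) = 1"
  shows "exp (\<Sum>i\<in>I. w i * z i) \<le> (\<Sum>i\<in>I. w i * exp (z i))"
  using convex_on_sum[OF assms(1) _ exp_convex, of w z] assms by fastforce

text \<open>Change of measure from \<open>q\<close> to \<open>p\<close>. Positivity is asked only of
  the letters that occur, as supports may be proper subsets of the alphabet.\<close>

lemma iid_density_change:
  assumes "xs \<in> words n" "\<And>a. a \<in> set xs \<Longrightarrow> 0 < p $ a \<and> 0 < q $ a"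
  shows "iid_density n p xs = iid_density n q xs * exp (sum_list (map (\<lambda>a. ln (p $ a / q $ a)) xs))"
proof -
  have "prod_list (map (\<lambda>a. p $ a) xs)
    = prod_list (map (\<lambda>a. q $ a) xs) * exp (sum_list (map (\<lambda>a. ln (p $ a / q $ a)) xs))"
    using assms(2)
  proof (induction xs)
    case (Cons a xs)
    then have "0 < p $ a" "0 < q $ a" by auto
    moreover note Cons.IH[OF Cons.prems[OF list.set_intros(2)]]
    ultimately show ?case by (simp add: exp_add)
  qed simp
  then show ?thesis using assms(1) by (simp add: iid_density_eq_prod_list)
qed

text \<open>The bet \<open>e\<close> is kept separate from any likelihood ratio, so that a bet
  scaled down to become fair on a larger set is covered. The type II bound comes from the
  supermartingale, the bound under \<rho> from a change of measure to \<tau>.\<close>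

lemma sc_adv_le_of_evalue:
  fixes \<rho> \<tau> :: "real ^ 'x::finite"
  assumes \<rho>: "\<rho> \<in> densities" and \<tau>: "\<tau> \<in> densities"
    and A: "A \<subseteq> densities" "A \<noteq> {}"
    and e: "\<And>a. 0 \<le> e a" and fair: "\<And>q. q \<in> A \<Longrightarrow> (\<Sum>a\<in>UNIV. q $ a * e a) \<le> 1"
    and pos: "\<And>a. \<tau> $ a \<noteq> 0 \<Longrightarrow> 0 < \<rho> $ a \<and> 0 < e a"
  shows "sc_adv r \<rho> A \<le> ereal ((\<Sum>a\<in>UNIV. \<tau> $ a * ln (\<tau> $ a / \<rho> $ a))
    + max 0 (r - (\<Sum>a\<in>UNIV. \<tau> $ a * ln (e a))))"
proof -
  define T where "T n xs = min 1 (exp (- real n * r) * prod_list (map e xs))" for n and xs :: "'x list"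
  have prod_nn: "0 \<le> prod_list (map e xs)" for xs
    using e by (intro prod_list_nonneg) auto
  have test: "is_test n (T n)" for n
    using prod_nn by (auto simp: is_test_def T_def)
  \<comment> \<open>Dropping the minimum with 1 leaves the mean wealth, scaled by
    \<open>exp (- n r)\<close>.\<close>
  have sup: "(SUP \<omega>\<in>adv_hyp A n. test_val n \<omega> (T n)) \<le> exp (- real n * r)" if "0 < n" for n
  proof (rule cSUP_least)
    show "adv_hyp A n \<noteq> {}" using adv_hyp_nonempty A that by blast
  next
    fix \<omega> assume \<omega>: "\<omega> \<in> adv_hyp A n"
    have "test_val n \<omega> (T n) \<le> (\<Sum>xs\<in>words n. \<omega> xs * (exp (- real n * r) * prod_list (map e xs)))"
      unfolding test_val_def T_def using \<omega>
      by (intro sum_mono mult_left_mono) (auto simp: adv_hyp_def word_densities_def)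
    also have "\<dots> = exp (- real n * r) * (\<Sum>xs\<in>words n. \<omega> xs * prod_list (map e xs))"
      by (simp add: sum_distrib_left mult_ac)
    also have "\<dots> \<le> exp (- real n * r) * 1"
      using adv_hyp_evalue[OF \<omega> e fair] by (intro mult_left_mono) auto
    finally show "test_val n \<omega> (T n) \<le> exp (- real n * r)" by simp
  qed
  have "ereal r \<le> err_rate n (SUP \<omega>\<in>adv_hyp A n. test_val n \<omega> (T n))" if n: "0 < n" for n
    unfolding err_rate_exp[OF n, symmetric]
    using sup[OF n] adv_hyp_nonempty[OF A n] test
    by (intro err_rate_antimono SUP_test_val_nonneg) (auto simp: adv_hyp_def)
  then have liminf: "ereal r \<le> liminf (\<lambda>n. err_rate n (SUP \<omega>\<in>adv_hyp A n. test_val n \<omega> (T n)))"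
    by (intro Liminf_bounded eventually_mono[OF eventually_gt_at_top[of 0]])

  \<comment> \<open>Success exponent of the test under the null hypothesis\<close>
  define m where "m = (\<Sum>a\<in>UNIV. \<tau> $ a * ln (e a))"
  define g where "g a = ln (e a) - m" for a
  define V where "V = (\<Sum>a\<in>UNIV. \<tau> $ a * (g a)\<^sup>2)"
  define D where "D = (\<Sum>a\<in>UNIV. \<tau> $ a * ln (\<tau> $ a / \<rho> $ a))"
  define h where "h = max 0 (r - m)"
  \<comment> \<open>On words in the support of \<tau>, \<open>Z\<close> bounds from below the
    logarithm of \<open>T\<close> times the density ratio of \<rho> to \<tau>. The fluctuation of
    the log wealth enters through a quadratic bound, so that its mean under the product of \<tau> is
    given by the variance \<open>V\<close>.\<close>
  define Z where "Z n xs = sum_list (map (\<lambda>a. ln (\<rho> $ a / \<tau> $ a)) xs) - real n * h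
     - ((sum_list (map g xs))\<^sup>2 / sqrt n + sqrt n) / 2" for n xs
  have sum\<tau>: "(\<Sum>a\<in>UNIV. \<tau> $ a) = 1" and \<tau>nn: "0 \<le> \<tau> $ a" for a
    using \<tau> by (auto simp: densities_def)
  have mean_g: "(\<Sum>a\<in>UNIV. \<tau> $ a * g a) = 0"
    by (simp add: g_def right_diff_distrib sum_subtractf sum\<tau> m_def flip: sum_distrib_right)
  have V_nn: "0 \<le> V" unfolding V_def using \<tau>nn by (intro sum_nonneg) auto
  have D_eq: "(\<Sum>a\<in>UNIV. \<tau> $ a * ln (\<rho> $ a / \<tau> $ a)) = - D"
    unfolding D_def sum_negf[symmetric]
  proof (intro sum.cong refl)
    fix a show "\<tau> $ a * ln (\<rho> $ a / \<tau> $ a) = - (\<tau> $ a * ln (\<tau> $ a / \<rho> $ a))"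
      using pos[of a] \<tau>nn[of a] by (cases "\<tau> $ a = 0") (auto simp: ln_div algebra_simps)
  qed
  have pointwise: "iid_density n \<tau> xs * exp (Z n xs) \<le> iid_density n \<rho> xs * T n xs"
    if n: "0 < n" and xs: "xs \<in> words n" for n xs
  proof (cases "\<forall>a\<in>set xs. \<tau> $ a \<noteq> 0")
    case False
    then have "iid_density n \<tau> xs = 0"
      using xs by (auto simp: iid_density_eq_prod_list prod_list_zero_iff)
    moreover have "0 \<le> iid_density n \<rho> xs"
      unfolding iid_density_def using \<rho> by (intro prod_density_nonneg) auto
    ultimately show ?thesis using prod_nn by (simp add: T_def)
  next
    case True
    define u where "u = sum_list (map g xs)"
    define l where "l = sum_list (map (\<lambda>a. ln (\<rho> $ a / \<tau> $ a)) xs)"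
    have "prod_list (map e xs) = exp (sum_list (map (\<lambda>a. ln (e a)) xs))"
      using True pos by (induction xs) (simp_all add: exp_add)
    also have "sum_list (map (\<lambda>a. ln (e a)) xs) = u + real (length xs) * m"
      unfolding u_def g_def by (induction xs) (simp_all add: algebra_simps)
    also have "length xs = n" using xs by (simp add: words_def)
    finally have T: "T n xs = min 1 (exp (u - real n * (r - m)))"
      by (simp add: T_def algebra_simps flip: exp_add)
    \<comment> \<open>The arithmetic-geometric mean inequality, weighted by \<open>sqrt n\<close>
      because the mean of \<open>u\<close> squared is of order \<open>n\<close>: both terms then
      cost order \<open>sqrt n\<close>, which is negligible against \<open>n\<close>.\<close>
    have "\<bar>u\<bar> \<le> (u\<^sup>2 / sqrt n + sqrt n) / 2"
    proof -
      have "0 \<le> (\<bar>u\<bar> - sqrt n)\<^sup>2 / sqrt n" using n by simp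
      also have "\<dots> = u\<^sup>2 / sqrt n + sqrt n - 2 * \<bar>u\<bar>"
        using n by (simp add: power2_diff field_simps)
      finally show ?thesis by simp
    qed
    \<comment> \<open>The right-hand side is the logarithm of \<open>T n xs\<close>; the inequality
      holds because \<open>h\<close> dominates both 0 and \<open>r - m\<close>.\<close>
    moreover have "- (real n * h) - \<bar>u\<bar> \<le> min 0 (u - real n * (r - m))"
    proof -
      have "real n * (r - m) \<le> real n * h" "0 \<le> real n * h"
        by (auto simp: h_def intro!: mult_left_mono)
      then show ?thesis by linarith
    qed
    ultimately have "Z n xs \<le> l + min 0 (u - real n * (r - m))"
      unfolding Z_def u_def[symmetric] l_def[symmetric] by linarith
    then have "exp (Z n xs) \<le> exp l * exp (min 0 (u - real n * (r - m)))"
      by (simp flip: exp_add)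
    also have "exp (min 0 (u - real n * (r - m))) = T n xs"
      unfolding T by (simp add: min_def)
    finally have "iid_density n \<tau> xs * exp (Z n xs) \<le> iid_density n \<tau> xs * (exp l * T n xs)"
      unfolding iid_density_def using \<tau>
      by (intro mult_left_mono prod_density_nonneg) auto
    also have "\<dots> = iid_density n \<rho> xs * T n xs"
      using True pos \<tau>nn iid_density_change[OF xs, of \<rho> \<tau>]
      by (simp add: l_def less_le)
    finally show ?thesis .
  qed
  \<comment> \<open>Chosen so that the mean of \<open>Z n\<close> under the product of \<tau> is
    \<open>- n * c n\<close>. In the vanishing term, \<open>V\<close> stems from the variance and 1
    from the \<open>sqrt n\<close> in \<open>Z\<close>.\<close>
  define c where "c n = D + h + (V + 1) / 2 / sqrt n" for n :: nat
  have rate: "err_rate n (test_val n (iid_density n \<rho>) (T n)) \<le> ereal (c n)" if n: "0 < n" for n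
  proof -
    have 1: "(\<Sum>xs\<in>words n. iid_density n \<tau> xs) = 1"
      unfolding iid_density_def using \<tau> by (intro sum_prod_density)
    have "(\<Sum>xs\<in>words n. iid_density n \<tau> xs * Z n xs)
      = (\<Sum>xs\<in>words n. iid_density n \<tau> xs * sum_list (map (\<lambda>a. ln (\<rho> $ a / \<tau> $ a)) xs))
        - (\<Sum>xs\<in>words n. iid_density n \<tau> xs) * (real n * h + sqrt n / 2)
        - (\<Sum>xs\<in>words n. iid_density n \<tau> xs * (sum_list (map g xs))\<^sup>2) / (2 * sqrt n)"
      unfolding Z_def sum_distrib_right sum_divide_distrib sum_subtractf[symmetric]
      by (intro sum.cong refl) (simp add: field_simps)
    also have "\<dots> = - real n * D - (real n * h + sqrt n / 2) - real n * V / (2 * sqrt n)"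
      unfolding sum_iid_sum_list[OF \<tau>] sum_iid_sum_list_squared[OF \<tau> mean_g] 1 D_eq V_def
      by simp
    also have "\<dots> = - real n * c n"
    proof -
      have "real n * ((V + 1) / 2 / sqrt n) = (V + 1) / 2 * (real n / sqrt n)"
        and "real n * V / (2 * sqrt n) = V / 2 * (real n / sqrt n)"
        by simp_all
      then have "real n * ((V + 1) / 2 / sqrt n) = (V + 1) / 2 * sqrt n"
        and "real n * V / (2 * sqrt n) = V / 2 * sqrt n"
        by (simp_all add: real_div_sqrt)
      moreover have "- real n * c n = - real n * D - real n * h - real n * ((V + 1) / 2 / sqrt n)"
        unfolding c_def by (simp only: distrib_left minus_mult_left[symmetric])
      ultimately show ?thesis by (simp only: add_divide_distrib distrib_right)
    qed
    finally have EZ: "(\<Sum>xs\<in>words n. iid_density n \<tau> xs * Z n xs) = - real n * c n" .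
    have "exp (- real n * c n) \<le> (\<Sum>xs\<in>words n. iid_density n \<tau> xs * exp (Z n xs))"
      unfolding EZ[symmetric] using \<tau> 1
      by (intro exp_mean_le_mean_exp) (auto simp: iid_density_def intro!: prod_density_nonneg)
    also have "\<dots> \<le> test_val n (iid_density n \<rho>) (T n)"
      unfolding test_val_def using pointwise[OF n] by (intro sum_mono)
    finally show ?thesis
      unfolding err_rate_exp[OF n, symmetric] by (intro err_rate_antimono) auto
  qed
  have "c \<longlonglongrightarrow> D + h"
  proof -
    have "(\<lambda>n. (V + 1) / 2 / sqrt (real n)) \<longlonglongrightarrow> 0"
      by (intro tendsto_divide_0[OF tendsto_const] filterlim_at_top_imp_at_infinity
          filterlim_compose[OF sqrt_at_top filterlim_real_sequentially])
    from tendsto_add[OF tendsto_const this, of "D + h"]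
    show ?thesis unfolding c_def[abs_def] by (simp only: add_0_right)
  qed
  then have "limsup (\<lambda>n. ereal (c n)) = ereal (D + h)"
    by (intro lim_imp_Limsup) auto
  moreover have "limsup (\<lambda>n. err_rate n (test_val n (iid_density n \<rho>) (T n))) \<le> limsup (\<lambda>n. ereal (c n))"
    using rate by (intro Limsup_mono eventually_mono[OF eventually_gt_at_top[of 0]])
  ultimately have "limsup (\<lambda>n. err_rate n (test_val n (iid_density n \<rho>) (T n))) \<le> ereal (D + h)"
    by simp
  moreover have "sc_adv r \<rho> A \<le> limsup (\<lambda>n. err_rate n (test_val n (iid_density n \<rho>) (T n)))"
    unfolding sc_adv_def sc_exp_def using test liminf by (intro Inf_lower) auto
  ultimately show ?thesis unfolding D_def h_def m_def by (rule order_trans[rotated])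
qed

subsection \<open>Hoelder's bound for a simple alternative\<close>

text \<open>Hoelder's inequality with exponents \<alpha> and \<alpha> / (\<alpha> - 1). The type II
  error enters through a positive upper bound \<open>t\<close>, so that one may divide by
  \<open>t\<close> even if the error is 0.\<close>

lemma test_val_le_renyi:
  fixes p q :: "real ^ 'x::finite"
  assumes \<alpha>: "1 < \<alpha>" and p: "p \<in> densities" and q: "q \<in> densities"
    and supp: "supp p \<subseteq> supp q" and T: "is_test n T"
    and t: "0 < t" "test_val n (iid_density n q) T \<le> t"
    and w: "w = (\<Sum>a\<in>supp p. (p $ a) powr \<alpha> * (q $ a) powr (1 - \<alpha>))"
  shows "test_val n (iid_density n p) T \<le> (w ^ n) powr (1 / \<alpha>) * t powr (1 - 1 / \<alpha>)"
proof -
  define f where "f a = (p $ a) powr \<alpha> * (q $ a) powr (1 - \<alpha>)" for a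
  have nn: "0 \<le> p $ a" "0 \<le> q $ a" for a using p q by (auto simp: densities_def)
  have qpos: "0 < q $ a" if "p $ a \<noteq> 0" for a
    using supp that nn(2)[of a] by (auto simp: supp_def less_le)
  have w_UNIV: "w = (\<Sum>a\<in>UNIV. f a)"
    unfolding w f_def by (rule sum.mono_neutral_left) (auto simp: supp_def)
  have f_nn: "0 \<le> f a" for a by (simp add: f_def)
  have "w \<noteq> 0"
  proof
    assume "w = 0"
    then have f0: "f a = 0" for a
      using sum_nonneg_eq_0_iff[of UNIV f] f_nn w_UNIV by simp
    have "p $ a = 0" for a
      using f0[of a] qpos[of a] nn(1)[of a] by (cases "p $ a = 0") (auto simp: f_def)
    then show False using p by (simp add: densities_def)
  qed
  then have w_pos: "0 < w" using f_nn sum_nonneg[of UNIV f] w_UNIV by (simp add: less_le)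
  define W where "W = w ^ n"
  have W: "0 < W" using w_pos by (simp add: W_def)
  define k where "k = W powr (1 / \<alpha>) * t powr (1 - 1 / \<alpha>)"
  text \<open>Young's inequality for the two factors of \<open>p = f powr (1/\<alpha>) * q powr (1 - 1/\<alpha>)\<close>,
    normalised by \<open>W\<close> and \<open>t\<close>.\<close>
  have pointwise: "iid_density n p xs * T xs
      \<le> k * (1 / \<alpha> * (prod_list (map f xs) / W) + (1 - 1 / \<alpha>) * (iid_density n q xs * T xs / t))"
    if xs: "xs \<in> words n" for xs
  proof (cases "T xs = 0 \<or> (\<exists>a\<in>set xs. p $ a = 0)")
    case True
    have "iid_density n p xs * T xs = 0"
      using True xs by (auto simp: iid_density_eq_prod_list prod_list_zero_iff)
    have x: "0 \<le> prod_list (map f xs) / W"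
      using W by (intro divide_nonneg_pos prod_list_nonneg) (auto simp: f_nn)
    have "0 \<le> iid_density n q xs * T xs"
      using T xs q unfolding iid_density_def
      by (intro mult_nonneg_nonneg prod_density_nonneg) (auto simp: is_test_def)
    then have y: "0 \<le> iid_density n q xs * T xs / t"
      using t(1) by (rule divide_nonneg_pos)
    have "0 \<le> k * (1 / \<alpha> * x + (1 - 1 / \<alpha>) * y)" if "0 \<le> x" "0 \<le> y" for x y
      using that \<alpha> by (intro mult_nonneg_nonneg add_nonneg_nonneg) (simp_all add: k_def)
    from this[OF x y] show ?thesis
      unfolding \<open>iid_density n p xs * T xs = 0\<close> .
  next
    case False
    have Txs: "0 < T xs" "T xs \<le> 1" using T xs False by (auto simp: is_test_def less_le)
    define P where "P = prod_list (map (\<lambda>a. p $ a) xs)"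
    define Q where "Q = prod_list (map (\<lambda>a. q $ a) xs)"
    define F where "F = prod_list (map f xs)"
    have "P = F powr (1 / \<alpha>) * Q powr (1 - 1 / \<alpha>) \<and> 0 < F \<and> 0 < Q"
    proof -
      have *: "p $ a = f a powr (1 / \<alpha>) * (q $ a) powr (1 - 1 / \<alpha>) \<and> 0 < f a \<and> 0 < q $ a"
        \<comment> \<open>The density \<open>p\<close> is a geometric mean of \<open>f\<close> and
          \<open>q\<close>: the exponents of \<open>q\<close> cancel.\<close>
        if "p $ a \<noteq> 0" for a
      proof -
        have "0 < p $ a" "0 < q $ a" using that nn(1)[of a] qpos by (auto simp: less_le)
        moreover from this have "f a powr (1 / \<alpha>) * (q $ a) powr (1 - 1 / \<alpha>)
            = p $ a * (q $ a) powr ((1 - \<alpha>) / \<alpha> + (1 - 1 / \<alpha>))"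
          using \<alpha> by (simp add: f_def powr_mult powr_powr powr_add)
        moreover have "(1 - \<alpha>) / \<alpha> + (1 - 1 / \<alpha>) = 0" using \<alpha> by (simp add: field_simps)
        ultimately show ?thesis by (simp add: f_def)
      qed
      have "\<forall>a\<in>set xs. p $ a \<noteq> 0" using False by auto
      then show ?thesis unfolding P_def F_def Q_def
      proof (induction xs)
        case (Cons a xs)
        then have IH: "prod_list (map (\<lambda>a. p $ a) xs)
            = prod_list (map f xs) powr (1 / \<alpha>) * prod_list (map (\<lambda>a. q $ a) xs) powr (1 - 1 / \<alpha>)"
          "0 < prod_list (map f xs)" "0 < prod_list (map (\<lambda>a. q $ a) xs)" by auto
        from *[of a] Cons.prems have a: "p $ a = f a powr (1 / \<alpha>) * (q $ a) powr (1 - 1 / \<alpha>)"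
          "0 < f a" "0 < q $ a" by auto
        show ?case
          using IH(2,3) a(2,3)
          by (simp only: list.map prod_list.Cons IH(1) powr_mult) (simp add: a(1)[symmetric] mult_ac powr_mult)
      qed simp
    qed
    then have PFQ: "P = F powr (1 / \<alpha>) * Q powr (1 - 1 / \<alpha>)" and F: "0 < F" and Q: "0 < Q"
      by auto
    have "P * T xs = F powr (1 / \<alpha>) * (Q powr (1 - 1 / \<alpha>) * T xs powr 1)"
      using Txs PFQ by simp
    \<comment> \<open>Lowering the exponent of a number in (0, 1] enlarges it, which gives
      \<open>T\<close> the same exponent as \<open>Q\<close>.\<close>
    also have "\<dots> \<le> F powr (1 / \<alpha>) * (Q powr (1 - 1 / \<alpha>) * T xs powr (1 - 1 / \<alpha>))"
      using Txs \<alpha> by (intro mult_left_mono powr_mono') auto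
    also have "\<dots> = k * ((F / W) powr (1 / \<alpha>) * (Q * T xs / t) powr (1 - 1 / \<alpha>))"
      using W t(1) F Q Txs by (simp add: k_def powr_mult powr_divide)
    also have "\<dots> \<le> k * (1 / \<alpha> * (F / W) + (1 - 1 / \<alpha>) * (Q * T xs / t))"
      using \<alpha> W t(1) F Q Txs by (intro mult_left_mono Youngs_inequality_0) (auto simp: k_def)
    finally show ?thesis using xs by (simp add: iid_density_eq_prod_list P_def Q_def F_def)
  qed
  have "test_val n (iid_density n p) T
    \<le> (\<Sum>xs\<in>words n. k * (1 / \<alpha> * (prod_list (map f xs) / W)
        + (1 - 1 / \<alpha>) * (iid_density n q xs * T xs / t)))"
    unfolding test_val_def using pointwise by (intro sum_mono)
  also have "\<dots> = k * (1 / \<alpha> * ((\<Sum>xs\<in>words n. prod_list (map f xs)) / W)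
        + (1 - 1 / \<alpha>) * (test_val n (iid_density n q) T / t))"
    by (simp only: sum_distrib_left[symmetric] sum.distrib sum_divide_distrib[symmetric] test_val_def)
  also have "(\<Sum>xs\<in>words n. prod_list (map f xs)) = W"
    by (simp add: sum_words_prod_list W_def w_UNIV)
  also have "k * (1 / \<alpha> * (W / W) + (1 - 1 / \<alpha>) * (test_val n (iid_density n q) T / t))
     \<le> k * (1 / \<alpha> * (W / W) + (1 - 1 / \<alpha>) * 1)"
    using t \<alpha> by (intro mult_left_mono add_left_mono) (auto simp: k_def)
  also have "\<dots> = k" using W by simp
  finally show ?thesis by (simp add: k_def W_def)
qed

lemma sum_density_supp_pos:
  assumes "p \<in> densities" "\<And>a. a \<in> supp p \<Longrightarrow> 0 < f a"
  shows "0 < (\<Sum>a\<in>supp p. f a :: real)"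
proof (rule sum_pos)
  show "supp p \<noteq> {}"
  proof
    assume "supp p = {}"
    then have "p $ a = 0" for a by (auto simp: supp_def)
    then show False using assms(1) by (simp add: densities_def)
  qed
qed (use assms in auto)

lemma iid_test_val_bounds:
  assumes "p \<in> densities" "is_test n T"
  shows "0 \<le> test_val n (iid_density n p) T" "test_val n (iid_density n p) T \<le> 1"
  using assms prod_density_in_word_densities[of n "\<lambda>_. p"]
  by (auto simp: iid_density_def word_densities_def intro!: test_val_nonneg test_val_le_1)

lemma err_rate_nonneg: "0 \<le> t \<Longrightarrow> t \<le> 1 \<Longrightarrow> 0 \<le> err_rate n t"
  using err_rate_antimono[of t 1 n] by simp

lemma iid_hyp_singleton [simp]: "iid_hyp {q} n = {iid_density n q}"
  by (auto simp: iid_hyp_def)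

lemma hoeffding_anti_le_sc_simple:
  fixes p q :: "real ^ 'x::finite"
  assumes p: "p \<in> densities" and q: "q \<in> densities"
  shows "hoeffding_anti r p q \<le> sc_simple r p q"
  unfolding sc_simple_def sc_iid_def sc_exp_def
proof (rule Inf_greatest, safe)
  fix T :: "nat \<Rightarrow> 'x list \<Rightarrow> real"
  assume T: "\<forall>n. is_test n (T n)"
    and "ereal r \<le> liminf (\<lambda>n. err_rate n (SUP \<omega>\<in>iid_hyp {q} n. test_val n \<omega> (T n)))"
  then have lim: "ereal r \<le> liminf (\<lambda>n. err_rate n (test_val n (iid_density n q) (T n)))"
    by simp
  let ?L = "limsup (\<lambda>n. err_rate n (test_val n (iid_density n p) (T n)))"
  have le_L: "y \<le> ?L" if "\<forall>\<^sub>F n in sequentially. y \<le> err_rate n (test_val n (iid_density n p) (T n))" for y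
    using Limsup_mono[OF that] by (simp add: Limsup_const)
  have 0: "0 \<le> ?L"
    using p T by (intro le_L always_eventually allI err_rate_nonneg iid_test_val_bounds) auto
  have "ereal ((\<alpha> - 1) / \<alpha>) * (ereal r - renyi_div \<alpha> p q) \<le> ?L" if \<alpha>: "1 < \<alpha>" for \<alpha>
  proof (cases "supp p \<subseteq> supp q")
    case False
    \<comment> \<open>Here the Renyi divergence is \<infinity>, so the left-hand side is
      -\<infinity>.\<close>
    then show ?thesis using \<alpha> by (simp add: renyi_div_def)
  next
    case True
    define w where "w = (\<Sum>a\<in>supp p. (p $ a) powr \<alpha> * (q $ a) powr (1 - \<alpha>))"
    have nn: "0 \<le> p $ a" "0 \<le> q $ a" for a using p q by (auto simp: densities_def)
    have w: "0 < w" unfolding w_def using True nn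
      by (intro sum_density_supp_pos[OF p] mult_pos_pos) (auto simp: supp_def)
    have eq: "ereal ((\<alpha> - 1) / \<alpha>) * (ereal r - renyi_div \<alpha> p q) = ereal ((1 - 1 / \<alpha>) * r - ln w / \<alpha>)"
      using True \<alpha> by (simp add: renyi_div_def w_def field_simps)
    \<comment> \<open>A liminf of at least \<open>r\<close> only makes the type II error eventually
      at most \<open>exp (- n s)\<close> for each \<open>s < r\<close>; the bound at
      \<open>r\<close> follows by letting \<open>s\<close> tend to \<open>r\<close> from the
      left.\<close>
    have step: "ereal ((1 - 1 / \<alpha>) * s - ln w / \<alpha>) \<le> ?L" if s: "s < r" for s
    proof (rule le_L)
      have "ereal s < liminf (\<lambda>n. err_rate n (test_val n (iid_density n q) (T n)))"
        using s lim by (meson ereal_less_le less_ereal.simps(1) order_less_le_trans)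
      then have "\<forall>\<^sub>F n in sequentially. ereal s < err_rate n (test_val n (iid_density n q) (T n))"
        by (rule less_LiminfD)
      then show "\<forall>\<^sub>F n in sequentially. ereal ((1 - 1 / \<alpha>) * s - ln w / \<alpha>)
          \<le> err_rate n (test_val n (iid_density n p) (T n))"
        using eventually_gt_at_top[of 0]
      proof eventually_elim
        case (elim n)
        let ?t = "test_val n (iid_density n q) (T n)"
        have t0: "0 \<le> ?t" using iid_test_val_bounds q T by blast
        have "?t \<le> exp (- real n * s)"
        proof (rule ccontr)
          assume "\<not> ?thesis"
          then have "err_rate n ?t \<le> ereal s"
            unfolding err_rate_exp[OF elim(2), symmetric] by (intro err_rate_antimono) auto
          then show False using elim(1) by simp
        qed
        from test_val_le_renyi[OF \<alpha> p q True T[rule_format] _ this w_def]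
        have "test_val n (iid_density n p) (T n)
            \<le> (w ^ n) powr (1 / \<alpha>) * exp (- real n * s) powr (1 - 1 / \<alpha>)" by simp
        also have "\<dots> = exp (- real n * ((1 - 1 / \<alpha>) * s - ln w / \<alpha>))"
          using w by (simp add: powr_def ln_realpow algebra_simps flip: exp_add)
        finally show ?case
          unfolding err_rate_exp[OF elim(2), symmetric]
          using p T by (intro err_rate_antimono iid_test_val_bounds(1)) auto
      qed
    qed
    have "((\<lambda>s. ereal ((1 - 1 / \<alpha>) * s - ln w / \<alpha>)) \<longlongrightarrow> ereal ((1 - 1 / \<alpha>) * r - ln w / \<alpha>)) (at_left r)"
      by (intro tendsto_intros)
    then show ?thesis
      unfolding eq
      by (rule tendsto_upperbound) (auto simp: eventually_at_filter intro!: always_eventually step)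
  qed
  then show "hoeffding_anti r p q \<le> ?L"
    using 0 by (auto simp: hoeffding_anti_def intro!: SUP_least)
qed

subsection \<open>Closed convex hulls of sets of densities\<close>

text \<open>A half-space is convex and closed, so it contains the closed convex hull of its subsets.
  The coordinates are read through \<open>f\<close> because the functional in use sums over words,
  many of which share a letter.\<close>

lemma closure_hull_subset_halfspace:
  fixes S :: "(real ^ 'x::finite) set" and k :: "'i \<Rightarrow> real"
  assumes "\<And>v. v \<in> S \<Longrightarrow> (\<Sum>i\<in>I. v $ f i * k i) \<le> B"
    and "v \<in> closure (convex hull S)"
  shows "(\<Sum>i\<in>I. v $ f i * k i) \<le> B"
proof -
  let ?L = "\<lambda>v::real ^ 'x. \<Sum>i\<in>I. v $ f i * k i"
  have lin: "?L (a *\<^sub>R x + b *\<^sub>R y) = a * ?L x + b * ?L y" for a b x y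
    by (simp add: sum_distrib_left sum.distrib[symmetric] algebra_simps)
  have "convex {v. ?L v \<le> B}"
    unfolding convex_def mem_Collect_eq lin by (auto intro: convex_bound_le)
  then have "convex hull S \<subseteq> {v. ?L v \<le> B}"
    using assms(1) by (intro hull_minimal) auto
  moreover have "closed {v. ?L v \<le> B}"
    by (intro closed_Collect_le continuous_intros)
  ultimately have "closure (convex hull S) \<subseteq> {v. ?L v \<le> B}"
    by (rule closure_minimal)
  then show ?thesis using assms(2) by blast
qed

text \<open>The value of a test is linear in each factor separately. Factors are therefore moved
  from \<open>S\<close> to the hull one at a time: with all others frozen, a bound valid for every
  choice of the \<open>j\<close>-th factor in \<open>S\<close> extends to the hull.\<close>

lemma test_val_prod_density_le_closure_hull:
  fixes S :: "(real ^ 'x::finite) set"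
  assumes S: "\<And>q. \<forall>i<n. q i \<in> S \<Longrightarrow> test_val n (prod_density n q) T \<le> B"
    and q: "\<forall>i<n. q i \<in> closure (convex hull S)"
  shows "test_val n (prod_density n q) T \<le> B"
proof -
  let ?C = "closure (convex hull S)"
  have "test_val n (prod_density n q) T \<le> B"
    if "j \<le> n" "\<forall>i<j. q i \<in> ?C" "\<forall>i. j \<le> i \<and> i < n \<longrightarrow> q i \<in> S" for j q
    using that
  proof (induction j arbitrary: q)
    case 0
    then show ?case using S by simp
  next
    case (Suc j)
    define k where "k xs = (\<Prod>i\<in>{..<n} - {j}. q i $ (xs ! i)) * T xs" for xs
    have eq: "test_val n (prod_density n (q(j := v))) T = (\<Sum>xs\<in>words n. v $ (xs ! j) * k xs)" for v
      unfolding test_val_def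
    proof (intro sum.cong refl)
      fix xs :: "'x list" assume "xs \<in> words n"
      then show "prod_density n (q(j := v)) xs * T xs = v $ (xs ! j) * k xs"
        using Suc.prems(1)
        by (simp add: prod_density_def k_def prod.remove[of "{..<n}" j])
    qed
    have "(\<Sum>xs\<in>words n. q j $ (xs ! j) * k xs) \<le> B"
    proof (rule closure_hull_subset_halfspace)
      fix v assume "v \<in> S"
      then have "test_val n (prod_density n (q(j := v))) T \<le> B"
        using Suc.prems by (intro Suc.IH) (auto simp: le_Suc_eq)
      then show "(\<Sum>xs\<in>words n. v $ (xs ! j) * k xs) \<le> B" unfolding eq .
    qed (use Suc.prems in auto)
    then show ?case unfolding eq[of "q j", symmetric] by simp
  qed
  note claim = this
  have "\<forall>i. n \<le> i \<and> i < n \<longrightarrow> q i \<in> S" by auto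
  from claim[OF order.refl q this] show ?thesis .
qed

lemma closed_densities: "closed (densities :: (real ^ 'x::finite) set)"
proof -
  have eq: "densities = (\<Inter>x. {p::real ^ 'x. 0 \<le> p $ x}) \<inter> {p. (\<Sum>x\<in>UNIV. p $ x) = 1}"
    by (auto simp: densities_def)
  then show ?thesis
    unfolding eq by (intro closed_Int closed_INT ballI closed_Collect_le closed_Collect_eq continuous_intros)
qed

lemma convex_densities: "convex (densities :: (real ^ 'x::finite) set)"
  by (auto simp: convex_def densities_def sum.distrib simp flip: sum_distrib_left)

lemma bounded_densities: "bounded (densities :: (real ^ 'x::finite) set)"
proof -
  have "norm p \<le> 1" if "p \<in> densities" for p :: "real ^ 'x"
    using norm_le_l1_cart[of p] that by (simp add: densities_def)
  then show ?thesis by (auto simp: bounded_iff)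
qed

lemma closure_hull_subset_densities:
  "S \<subseteq> densities \<Longrightarrow> closure (convex hull S) \<subseteq> densities"
  by (intro closure_minimal hull_minimal closed_densities convex_densities)

text \<open>Moving from the minimiser \<open>p\<close> towards \<open>q\<close> stays in
  \<open>K\<close>, so the one-sided derivative along this segment cannot be negative.\<close>

lemma first_order_minimum:
  fixes K :: "(real ^ 'x::finite) set"
  assumes "convex K" "p \<in> K" "q \<in> K"
    and deriv: "\<And>x. x \<in> P \<Longrightarrow> (\<phi> x has_real_derivative d x) (at (p $ x))"
    and min: "\<And>v. v \<in> K \<Longrightarrow> (\<Sum>x\<in>P. \<phi> x (p $ x)) \<le> (\<Sum>x\<in>P. \<phi> x (v $ x))"
  shows "0 \<le> (\<Sum>x\<in>P. d x * (q $ x - p $ x))"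
proof (rule ccontr)
  define F where "F t = (\<Sum>x\<in>P. \<phi> x (p $ x + t * (q $ x - p $ x)))" for t
  assume "\<not> ?thesis"
  moreover have "(F has_real_derivative (\<Sum>x\<in>P. d x * (q $ x - p $ x))) (at 0)"
    unfolding F_def
  proof (intro DERIV_sum)
    fix x assume "x \<in> P"
    then have "(\<phi> x has_real_derivative d x) (at (p $ x + 0 * (q $ x - p $ x)))"
      using deriv by simp
    moreover have "((\<lambda>t. p $ x + t * (q $ x - p $ x)) has_real_derivative (q $ x - p $ x)) (at 0)"
      by (auto intro!: derivative_eq_intros)
    ultimately show "((\<lambda>t. \<phi> x (p $ x + t * (q $ x - p $ x)))
        has_real_derivative d x * (q $ x - p $ x)) (at 0)"
      by (rule DERIV_chain2)
  qed
  ultimately obtain \<delta> where \<delta>: "\<delta> > 0" "\<And>h. 0 < h \<Longrightarrow> h < \<delta> \<Longrightarrow> F (0 + h) < F 0"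
    using DERIV_neg_dec_right[of F] by (metis not_le)
  define h where "h = min (\<delta> / 2) 1"
  have h: "0 < h" "h < \<delta>" "h \<le> 1" using \<delta> by (auto simp: h_def)
  have "(1 - h) *\<^sub>R p + h *\<^sub>R q \<in> K"
    using assms(1-3) h by (intro convexD_alt) auto
  from min[OF this] have "F 0 \<le> F h"
    by (simp add: F_def algebra_simps)
  then show False using \<delta>(2)[of h] h by simp
qed

subsection \<open>The saddle point\<close>

text \<open>Stationarity requires an attained maximum. Positivity of \<open>K\<close> on the support
  of \<rho> makes the objective continuous, and truncating \<alpha> to a compact interval costs the
  \<epsilon> in the conclusion.\<close>

lemma saddle_point:
  fixes \<rho> :: "real ^ 'x::finite" and K :: "(real ^ 'x) set"
  assumes K: "compact K" "convex K" "K \<noteq> {}" "K \<subseteq> densities"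
    and \<rho>: "\<rho> \<in> densities"
    and pos: "\<And>q x. q \<in> K \<Longrightarrow> x \<in> supp \<rho> \<Longrightarrow> 0 < q $ x"
    and r: "0 < r" and \<epsilon>: "0 < \<epsilon>" and M: "0 \<le> M"
    and bound: "\<And>q \<alpha>. q \<in> K \<Longrightarrow> 1 < \<alpha> \<Longrightarrow>
       ((\<alpha> - 1) * r - ln (\<Sum>x\<in>supp \<rho>. (\<rho> $ x) powr \<alpha> * (q $ x) powr (1 - \<alpha>))) / \<alpha> \<le> M"
  obtains \<tau> \<sigma> :: "real ^ 'x" where "\<tau> \<in> densities" "\<sigma> \<in> K" "\<forall>x. 0 < \<tau> $ x \<longleftrightarrow> x \<in> supp \<rho>"
    "\<forall>q\<in>K. (\<Sum>x\<in>supp \<rho>. \<tau> $ x / \<sigma> $ x * q $ x) \<le> 1"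
    "(\<Sum>x\<in>supp \<rho>. \<tau> $ x * ln (\<tau> $ x / \<rho> $ x))
       + max 0 (r - (\<Sum>x\<in>supp \<rho>. \<tau> $ x * ln (\<tau> $ x / \<sigma> $ x))) \<le> M + \<epsilon>"
proof -
  define P where "P = supp \<rho>"
  define W where "W \<alpha> q = (\<Sum>x\<in>P. (\<rho> $ x) powr \<alpha> * (q $ x) powr (1 - \<alpha>))" for \<alpha> and q :: "real ^ 'x"
  define G where "G \<alpha> q = ((\<alpha> - 1) * r - ln (W \<alpha> q)) / \<alpha>" for \<alpha> and q :: "real ^ 'x"
  have \<rho>pos: "0 < \<rho> $ x" if "x \<in> P" for x
    using \<rho> that by (auto simp: P_def supp_def densities_def less_le)
  have pos': "0 < q $ x" if "q \<in> K" "x \<in> P" for q x using pos that by (simp add: P_def)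
  have sum\<rho>: "(\<Sum>x\<in>P. \<rho> $ x) = 1"
  proof -
    have "(\<Sum>x\<in>P. \<rho> $ x) = (\<Sum>x\<in>UNIV. \<rho> $ x)"
      by (rule sum.mono_neutral_left) (auto simp: P_def supp_def)
    then show ?thesis using \<rho> by (simp add: densities_def)
  qed
  then have "P \<noteq> {}" by auto
  then have Wpos: "0 < W \<alpha> q" if "q \<in> K" for \<alpha> q
    unfolding W_def using that \<rho>pos pos' by (intro sum_pos) (auto simp: less_imp_neq[symmetric])
  have W1: "W 1 q = 1" if "q \<in> K" for q
  proof -
    have "W 1 q = (\<Sum>x\<in>P. \<rho> $ x)"
      unfolding W_def using that \<rho>pos pos' by (intro sum.cong) (auto simp: less_le)
    then show ?thesis using sum\<rho> by simp
  qed
  \<comment> \<open>The exponential family through \<open>q\<close> and \<rho>. The mean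
    \<open>m\<close> of the log-likelihood ratio under it is the \<alpha>-derivative of
    \<open>ln (W \<alpha> q)\<close>.\<close>
  define tilt :: "real \<Rightarrow> real ^ 'x \<Rightarrow> real ^ 'x"
    where "tilt \<alpha> q = (\<chi> x. if x \<in> P then (\<rho> $ x) powr \<alpha> * (q $ x) powr (1 - \<alpha>) / W \<alpha> q else 0)" for \<alpha> q
  define m where "m \<alpha> q = (\<Sum>x\<in>P. tilt \<alpha> q $ x * ln (\<rho> $ x / q $ x))" for \<alpha> q
  have tilt_pos: "0 < tilt \<alpha> q $ x \<longleftrightarrow> x \<in> P" if "q \<in> K" for \<alpha> q x
    using that \<rho>pos[of x] pos'[of q x] Wpos[of q \<alpha>] by (auto simp: tilt_def)
  have tilt_sum: "(\<Sum>x\<in>P. tilt \<alpha> q $ x) = 1" if "q \<in> K" for \<alpha> q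
    using Wpos[OF that, of \<alpha>] by (simp add: tilt_def W_def flip: sum_divide_distrib)
  have tilt_density: "tilt \<alpha> q \<in> densities" if "q \<in> K" for \<alpha> q
  proof -
    have "(\<Sum>x\<in>P. tilt \<alpha> q $ x) = (\<Sum>x\<in>UNIV. tilt \<alpha> q $ x)"
      by (rule sum.mono_neutral_left) (auto simp: tilt_def)
    moreover have "0 \<le> tilt \<alpha> q $ x" for x
      using Wpos[OF that, of \<alpha>] by (simp add: tilt_def)
    ultimately show ?thesis using tilt_sum[OF that] by (simp add: densities_def)
  qed
  have ln_tilt: "ln (tilt \<alpha> q $ x) = \<alpha> * ln (\<rho> $ x) + (1 - \<alpha>) * ln (q $ x) - ln (W \<alpha> q)"
    if "q \<in> K" "x \<in> P" for \<alpha> q x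
    using that \<rho>pos[of x] pos'[of q x] Wpos[of q \<alpha>]
    by (simp add: tilt_def ln_div ln_mult ln_powr)
  have D_\<sigma>: "(\<Sum>x\<in>P. tilt \<alpha> q $ x * ln (tilt \<alpha> q $ x / q $ x)) = \<alpha> * m \<alpha> q - ln (W \<alpha> q)"
    if q: "q \<in> K" for \<alpha> q
  proof -
    have "(\<Sum>x\<in>P. tilt \<alpha> q $ x * ln (tilt \<alpha> q $ x / q $ x))
      = (\<Sum>x\<in>P. \<alpha> * (tilt \<alpha> q $ x * ln (\<rho> $ x / q $ x)) - tilt \<alpha> q $ x * ln (W \<alpha> q))"
    proof (intro sum.cong refl)
      fix x assume x: "x \<in> P"
      from x \<rho>pos[of x] pos'[OF q, of x] tilt_pos[OF q, of \<alpha> x]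
      have "0 < \<rho> $ x" "0 < q $ x" "0 < tilt \<alpha> q $ x" by auto
      then show "tilt \<alpha> q $ x * ln (tilt \<alpha> q $ x / q $ x)
        = \<alpha> * (tilt \<alpha> q $ x * ln (\<rho> $ x / q $ x)) - tilt \<alpha> q $ x * ln (W \<alpha> q)"
        by (simp add: ln_div ln_tilt[OF q x] algebra_simps)
    qed
    also have "\<dots> = \<alpha> * m \<alpha> q - ln (W \<alpha> q)"
      unfolding sum_subtractf sum_distrib_left[symmetric] sum_distrib_right[symmetric] tilt_sum[OF q]
      by (simp add: m_def)
    finally show ?thesis .
  qed
  have D_\<rho>: "(\<Sum>x\<in>P. tilt \<alpha> q $ x * ln (tilt \<alpha> q $ x / \<rho> $ x)) = (\<alpha> - 1) * m \<alpha> q - ln (W \<alpha> q)"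
    if q: "q \<in> K" for \<alpha> q
  proof -
    have "(\<Sum>x\<in>P. tilt \<alpha> q $ x * ln (tilt \<alpha> q $ x / \<rho> $ x))
      = (\<Sum>x\<in>P. (\<alpha> - 1) * (tilt \<alpha> q $ x * ln (\<rho> $ x / q $ x)) - tilt \<alpha> q $ x * ln (W \<alpha> q))"
    proof (intro sum.cong refl)
      fix x assume x: "x \<in> P"
      from x \<rho>pos[of x] pos'[OF q, of x] tilt_pos[OF q, of \<alpha> x]
      have "0 < \<rho> $ x" "0 < q $ x" "0 < tilt \<alpha> q $ x" by auto
      then show "tilt \<alpha> q $ x * ln (tilt \<alpha> q $ x / \<rho> $ x)
        = (\<alpha> - 1) * (tilt \<alpha> q $ x * ln (\<rho> $ x / q $ x)) - tilt \<alpha> q $ x * ln (W \<alpha> q)"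
        by (simp add: ln_div ln_tilt[OF q x] algebra_simps)
    qed
    also have "\<dots> = (\<alpha> - 1) * m \<alpha> q - ln (W \<alpha> q)"
      unfolding sum_subtractf sum_distrib_left[symmetric] sum_distrib_right[symmetric] tilt_sum[OF q]
      by (simp add: m_def)
    finally show ?thesis .
  qed
  \<comment> \<open>By \<open>D_\<sigma>\<close> this is \<open>r\<close> minus the divergence of
    the tilted density from \<open>q\<close>; its sign is that of the \<alpha>-derivative of
    \<open>G\<close>.\<close>
  define h where "h \<alpha> q = r - (\<alpha> * m \<alpha> q - ln (W \<alpha> q))" for \<alpha> q
  have dG: "((\<lambda>\<alpha>. G \<alpha> q) has_real_derivative h \<alpha> q / \<alpha>\<^sup>2) (at \<alpha>)" if q: "q \<in> K" and \<alpha>: "1 \<le> \<alpha>" for \<alpha> q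
  proof -
    have dW: "((\<lambda>\<alpha>. W \<alpha> q) has_real_derivative W \<alpha> q * m \<alpha> q) (at \<alpha>)"
    proof -
      have "((\<lambda>\<alpha>. W \<alpha> q) has_real_derivative
          (\<Sum>x\<in>P. (\<rho> $ x) powr \<alpha> * (q $ x) powr (1 - \<alpha>) * ln (\<rho> $ x / q $ x))) (at \<alpha>)"
        unfolding W_def
      proof (intro DERIV_sum)
        fix x assume x: "x \<in> P"
        have "0 < \<rho> $ x" "0 < q $ x" using x \<rho>pos pos' q by auto
        then show "((\<lambda>\<alpha>. (\<rho> $ x) powr \<alpha> * (q $ x) powr (1 - \<alpha>)) has_real_derivative
          (\<rho> $ x) powr \<alpha> * (q $ x) powr (1 - \<alpha>) * ln (\<rho> $ x / q $ x)) (at \<alpha>)"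
          by (auto intro!: derivative_eq_intros simp: ln_div algebra_simps)
      qed
      moreover have "(\<Sum>x\<in>P. (\<rho> $ x) powr \<alpha> * (q $ x) powr (1 - \<alpha>) * ln (\<rho> $ x / q $ x)) = W \<alpha> q * m \<alpha> q"
        unfolding m_def sum_distrib_left
        using Wpos[OF q, of \<alpha>] by (intro sum.cong refl) (simp add: tilt_def)
      ultimately show ?thesis by simp
    qed
    have "((\<lambda>\<alpha>. G \<alpha> q) has_real_derivative
       ((r - W \<alpha> q * m \<alpha> q / W \<alpha> q) * \<alpha> - ((\<alpha> - 1) * r - ln (W \<alpha> q))) / (\<alpha> * \<alpha>)) (at \<alpha>)"
      unfolding G_def using Wpos[OF q, of \<alpha>] \<alpha>
      by (auto intro!: derivative_eq_intros dW)
    moreover have "((r - W \<alpha> q * m \<alpha> q / W \<alpha> q) * \<alpha> - ((\<alpha> - 1) * r - ln (W \<alpha> q))) / (\<alpha> * \<alpha>) = h \<alpha> q / \<alpha>\<^sup>2"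
      using Wpos[OF q, of \<alpha>] by (simp add: h_def power2_eq_square algebra_simps)
    ultimately show ?thesis by simp
  qed

  \<comment> \<open>The cut-off for \<alpha>, so large that a maximum attained there still gives a
    stationarity defect \<open>h / \<alpha>\<close> of at most \<epsilon>.\<close>
  define \<alpha>1 where "\<alpha>1 = 2 + r / \<epsilon>"
  have \<alpha>1: "1 < \<alpha>1" "r / \<alpha>1 \<le> \<epsilon>"
  proof -
    show "1 < \<alpha>1" using r \<epsilon> by (simp add: \<alpha>1_def add_pos_pos)
    have "r \<le> \<epsilon> * \<alpha>1" using r \<epsilon> by (simp add: \<alpha>1_def distrib_left)
    then show "r / \<alpha>1 \<le> \<epsilon>" using \<open>1 < \<alpha>1\<close> by (simp add: divide_le_eq)
  qed
  have "continuous_on ({1..\<alpha>1} \<times> K) (\<lambda>z. G (fst z) (snd z))"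
  proof -
    have "continuous_on ({1..\<alpha>1} \<times> K) (\<lambda>z. W (fst z) (snd z))"
      unfolding W_def
      by (intro continuous_intros) (use \<rho>pos pos' in \<open>fastforce simp: less_le\<close>)+
    then show ?thesis
      unfolding G_def
      by (intro continuous_intros) (use Wpos in \<open>fastforce simp: less_le\<close>)+
  qed
  moreover have "compact ({1..\<alpha>1} \<times> K)" using K by (intro compact_Times) auto
  moreover have "{1..\<alpha>1} \<times> K \<noteq> {}" using K \<alpha>1 by auto
  ultimately obtain z where z: "z \<in> {1..\<alpha>1} \<times> K"
    "\<forall>y\<in>{1..\<alpha>1} \<times> K. G (fst y) (snd y) \<le> G (fst z) (snd z)"
    using continuous_attains_sup by (metis (no_types, lifting))
  define \<alpha> \<sigma> where "\<alpha> = fst z" and "\<sigma> = snd z"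
  have \<alpha>: "1 \<le> \<alpha>" "\<alpha> \<le> \<alpha>1" and \<sigma>: "\<sigma> \<in> K"
    and max: "\<And>\<beta> q. 1 \<le> \<beta> \<Longrightarrow> \<beta> \<le> \<alpha>1 \<Longrightarrow> q \<in> K \<Longrightarrow> G \<beta> q \<le> G \<alpha> \<sigma>"
    using z by (auto simp: \<alpha>_def \<sigma>_def)
  have G1: "G 1 q = 0" if "q \<in> K" for q using W1[OF that] by (simp add: G_def)
  show thesis
  proof (cases "0 < G \<alpha> \<sigma>")
    case True
    then have \<alpha>gt: "1 < \<alpha>" using \<alpha> G1[OF \<sigma>] by (cases "\<alpha> = 1") auto
    \<comment> \<open>Since \<alpha> > 1 there is room to the left of the maximiser, so the
      derivative is not negative. There is room to the right only below the cut-off, hence the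
      condition in \<open>h_le\<close>.\<close>
    have h_ge: "0 \<le> h \<alpha> \<sigma>"
    proof (rule ccontr)
      assume "\<not> ?thesis"
      then have "h \<alpha> \<sigma> / \<alpha>\<^sup>2 < 0" using \<alpha>gt by (simp add: divide_neg_pos)
      from DERIV_neg_dec_left[OF dG[OF \<sigma> \<alpha>(1)] this]
      obtain \<delta> where \<delta>: "0 < \<delta>" "\<And>t. 0 < t \<Longrightarrow> t < \<delta> \<Longrightarrow> G \<alpha> \<sigma> < G (\<alpha> - t) \<sigma>" by auto
      define t where "t = min (\<delta> / 2) (\<alpha> - 1)"
      have "0 < t" "t < \<delta>" "1 \<le> \<alpha> - t" "\<alpha> - t \<le> \<alpha>1" using \<delta>(1) \<alpha>gt \<alpha> by (auto simp: t_def)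
      then show False using \<delta>(2)[of t] max[of "\<alpha> - t" \<sigma>] \<sigma> by simp
    qed
    have h_le: "h \<alpha> \<sigma> \<le> 0" if "\<alpha> \<noteq> \<alpha>1"
    proof (rule ccontr)
      assume "\<not> ?thesis"
      then have "h \<alpha> \<sigma> / \<alpha>\<^sup>2 > 0" using \<alpha>gt by simp
      from DERIV_pos_inc_right[OF dG[OF \<sigma> \<alpha>(1)] this]
      obtain \<delta> where \<delta>: "0 < \<delta>" "\<And>t. 0 < t \<Longrightarrow> t < \<delta> \<Longrightarrow> G \<alpha> \<sigma> < G (\<alpha> + t) \<sigma>" by auto
      define t where "t = min (\<delta> / 2) (\<alpha>1 - \<alpha>)"
      have "0 < t" "t < \<delta>" "1 \<le> \<alpha> + t" "\<alpha> + t \<le> \<alpha>1" using \<delta>(1) \<alpha>gt \<alpha> that by (auto simp: t_def)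
      then show False using \<delta>(2)[of t] max[of "\<alpha> + t" \<sigma>] \<sigma> by simp
    qed
    \<comment> \<open>Gibbs' inequality: \<open>r - h\<close> is a relative entropy whose second
      argument has mass at most 1 on \<open>P\<close>, hence nonnegative.\<close>
    have h_r: "h \<alpha> \<sigma> \<le> r"
    proof -
      have "(\<Sum>x\<in>P. tilt \<alpha> \<sigma> $ x - \<sigma> $ x) \<le> (\<Sum>x\<in>P. tilt \<alpha> \<sigma> $ x * ln (tilt \<alpha> \<sigma> $ x / \<sigma> $ x))"
      proof (rule sum_mono)
        fix x assume x: "x \<in> P"
        have p: "0 < tilt \<alpha> \<sigma> $ x" "0 < \<sigma> $ x" using tilt_pos[OF \<sigma>] pos'[OF \<sigma>] x by auto
        then have "ln (\<sigma> $ x / tilt \<alpha> \<sigma> $ x) \<le> \<sigma> $ x / tilt \<alpha> \<sigma> $ x - 1"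
          by (intro ln_le_minus_one) auto
        then have "1 - \<sigma> $ x / tilt \<alpha> \<sigma> $ x \<le> ln (tilt \<alpha> \<sigma> $ x / \<sigma> $ x)"
          using p by (simp add: ln_div)
        from mult_left_mono[OF this, of "tilt \<alpha> \<sigma> $ x"] p
        show "tilt \<alpha> \<sigma> $ x - \<sigma> $ x \<le> tilt \<alpha> \<sigma> $ x * ln (tilt \<alpha> \<sigma> $ x / \<sigma> $ x)"
          by (simp add: right_diff_distrib)
      qed
      moreover have "(\<Sum>x\<in>P. \<sigma> $ x) \<le> (\<Sum>x\<in>UNIV. \<sigma> $ x)"
        using \<sigma> K by (intro sum_mono2) (auto simp: densities_def)
      moreover have "(\<Sum>x\<in>UNIV. \<sigma> $ x) = 1" using \<sigma> K by (auto simp: densities_def)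
      ultimately show ?thesis
        by (simp add: sum_subtractf tilt_sum[OF \<sigma>] D_\<sigma>[OF \<sigma>] h_def)
    qed
    have "h \<alpha> \<sigma> / \<alpha> \<le> \<epsilon>"
    proof (cases "\<alpha> = \<alpha>1")
      case True
      then have "h \<alpha> \<sigma> / \<alpha> \<le> r / \<alpha>1" using h_r \<alpha>gt by (auto intro!: divide_right_mono)
      then show ?thesis using \<alpha>1 by simp
    next
      case False
      then show ?thesis using h_le h_ge \<epsilon> by simp
    qed
    moreover have "G \<alpha> \<sigma> \<le> M" using bound[OF \<sigma> \<alpha>gt] by (simp add: G_def W_def P_def)
    \<comment> \<open>Both sides equal \<open>r - m \<alpha> \<sigma>\<close>.\<close>
    moreover have "(\<alpha> - 1) * m \<alpha> \<sigma> - ln (W \<alpha> \<sigma>) + h \<alpha> \<sigma> = G \<alpha> \<sigma> + h \<alpha> \<sigma> / \<alpha>"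
      using \<alpha>gt by (simp add: G_def h_def field_simps)
    ultimately have val: "(\<Sum>x\<in>P. tilt \<alpha> \<sigma> $ x * ln (tilt \<alpha> \<sigma> $ x / \<rho> $ x))
       + max 0 (r - (\<Sum>x\<in>P. tilt \<alpha> \<sigma> $ x * ln (tilt \<alpha> \<sigma> $ x / \<sigma> $ x))) \<le> M + \<epsilon>"
      unfolding D_\<sigma>[OF \<sigma>] D_\<rho>[OF \<sigma>] h_def[symmetric] using h_ge by simp
    \<comment> \<open>At fixed \<alpha>, maximising \<open>G\<close> means minimising
      \<open>W\<close>. The first-order condition carries the negative factor
      \<open>(1 - \<alpha>) * W \<alpha> \<sigma>\<close>, and dividing by it reverses the
      inequality.\<close>
    have fair: "(\<Sum>x\<in>P. tilt \<alpha> \<sigma> $ x / \<sigma> $ x * q $ x) \<le> 1" if q: "q \<in> K" for q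
    proof -
      have min: "W \<alpha> \<sigma> \<le> W \<alpha> v" if "v \<in> K" for v
      proof -
        have "G \<alpha> v \<le> G \<alpha> \<sigma>" using max \<alpha> that by simp
        then have "ln (W \<alpha> \<sigma>) \<le> ln (W \<alpha> v)" using \<alpha>gt by (simp add: G_def divide_le_cancel)
        then show ?thesis using Wpos \<sigma> that by (simp add: ln_le_cancel_iff)
      qed
      have "0 \<le> (\<Sum>x\<in>P. (\<rho> $ x) powr \<alpha> * ((1 - \<alpha>) * (\<sigma> $ x) powr (- \<alpha>)) * (q $ x - \<sigma> $ x))"
      proof (rule first_order_minimum[OF K(2) \<sigma> q])
        fix x assume "x \<in> P"
        then show "((\<lambda>y. (\<rho> $ x) powr \<alpha> * y powr (1 - \<alpha>)) has_real_derivative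
            (\<rho> $ x) powr \<alpha> * ((1 - \<alpha>) * (\<sigma> $ x) powr (- \<alpha>))) (at (\<sigma> $ x))"
          using pos'[OF \<sigma>] by (auto intro!: derivative_eq_intros)
      next
        fix v assume "v \<in> K"
        from min[OF this] show "(\<Sum>x\<in>P. (\<rho> $ x) powr \<alpha> * (\<sigma> $ x) powr (1 - \<alpha>))
            \<le> (\<Sum>x\<in>P. (\<rho> $ x) powr \<alpha> * (v $ x) powr (1 - \<alpha>))" by (simp add: W_def)
      qed
      also have "\<dots> = (\<Sum>x\<in>P. (1 - \<alpha>) * W \<alpha> \<sigma> * (tilt \<alpha> \<sigma> $ x / \<sigma> $ x * q $ x - tilt \<alpha> \<sigma> $ x))"
      proof (intro sum.cong refl)
        fix x assume x: "x \<in> P"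
        have p: "0 < \<sigma> $ x" using pos'[OF \<sigma>] x by auto
        then have *: "(\<sigma> $ x) powr (- \<alpha>) = (\<sigma> $ x) powr (1 - \<alpha>) / \<sigma> $ x"
          using powr_diff[of "\<sigma> $ x" "1 - \<alpha>" 1] by simp
        show "(\<rho> $ x) powr \<alpha> * ((1 - \<alpha>) * (\<sigma> $ x) powr (- \<alpha>)) * (q $ x - \<sigma> $ x)
          = (1 - \<alpha>) * W \<alpha> \<sigma> * (tilt \<alpha> \<sigma> $ x / \<sigma> $ x * q $ x - tilt \<alpha> \<sigma> $ x)"
          unfolding * using p x Wpos[OF \<sigma>, of \<alpha>] by (simp add: tilt_def field_simps)
      qed
      also have "\<dots> = (1 - \<alpha>) * W \<alpha> \<sigma> * ((\<Sum>x\<in>P. tilt \<alpha> \<sigma> $ x / \<sigma> $ x * q $ x) - 1)"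
        by (simp only: sum_distrib_left[symmetric] sum_subtractf tilt_sum[OF \<sigma>])
      finally show ?thesis
        using \<alpha>gt Wpos[OF \<sigma>, of \<alpha>] by (auto simp: zero_le_mult_iff)
    qed
    show thesis
      using that[OF tilt_density[OF \<sigma>] \<sigma>, of \<alpha>] tilt_pos[OF \<sigma>] fair val unfolding P_def by blast
  next
    case False
    text \<open>The maximum over \<open>\<alpha>\<close> is at the boundary \<open>\<alpha> = 1\<close>: this forces \<open>r \<le> D(\<rho>\<parallel>q)\<close> on \<open>K\<close>,
      and \<open>\<tau> = \<rho>\<close> does.\<close>
    have D_ge: "r \<le> (\<Sum>x\<in>P. \<rho> $ x * ln (\<rho> $ x / q $ x))" if q: "q \<in> K" for q
    proof (rule ccontr)
      assume less: "\<not> ?thesis"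
      have "tilt 1 q $ x = \<rho> $ x" if "x \<in> P" for x
        using that \<rho>pos[of x] pos'[OF q, of x] W1[OF q] by (simp add: tilt_def)
      then have "m 1 q = (\<Sum>x\<in>P. \<rho> $ x * ln (\<rho> $ x / q $ x))" by (simp add: m_def)
      then have "0 < h 1 q / 1\<^sup>2" using less W1[OF q] by (simp add: h_def)
      from DERIV_pos_inc_right[OF dG[OF q order.refl] this]
      obtain \<delta> where \<delta>: "0 < \<delta>" "\<And>t. 0 < t \<Longrightarrow> t < \<delta> \<Longrightarrow> G 1 q < G (1 + t) q" by auto
      define t where "t = min (\<delta> / 2) (\<alpha>1 - 1)"
      have "0 < t" "t < \<delta>" "1 \<le> 1 + t" "1 + t \<le> \<alpha>1" using \<delta>(1) \<alpha>1 by (auto simp: t_def)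
      then show False using \<delta>(2)[of t] max[of "1 + t" q] q G1[OF q] False by simp
    qed
    \<comment> \<open>The partner of \<rho> is the minimiser \<open>q0\<close> of
      D(\<rho>\<parallel>q) over \<open>K\<close>, found by minimising the cross entropy, which
      differs by a constant. Its first-order condition is the fairness of the bet \<rho> /
      \<open>q0\<close>.\<close>
    have "continuous_on K (\<lambda>q. \<Sum>x\<in>P. - \<rho> $ x * ln (q $ x))"
      by (intro continuous_intros) (use pos' in \<open>fastforce simp: less_le\<close>)+
    then obtain q0 where q0: "q0 \<in> K"
      "\<And>v. v \<in> K \<Longrightarrow> (\<Sum>x\<in>P. - \<rho> $ x * ln (q0 $ x)) \<le> (\<Sum>x\<in>P. - \<rho> $ x * ln (v $ x))"
      using continuous_attains_inf[OF K(1,3)] by blast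
    have fair: "(\<Sum>x\<in>P. \<rho> $ x / q0 $ x * q $ x) \<le> 1" if q: "q \<in> K" for q
    proof -
      have "0 \<le> (\<Sum>x\<in>P. - \<rho> $ x / q0 $ x * (q $ x - q0 $ x))"
      proof (rule first_order_minimum[OF K(2) q0(1) q])
        fix x assume "x \<in> P"
        then show "((\<lambda>y. - \<rho> $ x * ln y) has_real_derivative - \<rho> $ x / q0 $ x) (at (q0 $ x))"
          using pos'[OF q0(1)] by (auto intro!: derivative_eq_intros)
      qed (use q0(2) in auto)
      also have "\<dots> = (\<Sum>x\<in>P. \<rho> $ x - \<rho> $ x / q0 $ x * q $ x)"
      proof (intro sum.cong refl)
        fix x assume "x \<in> P"
        then show "- \<rho> $ x / q0 $ x * (q $ x - q0 $ x) = \<rho> $ x - \<rho> $ x / q0 $ x * q $ x"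
          using pos'[OF q0(1), of x] by (simp add: field_simps)
      qed
      finally show ?thesis by (simp add: sum_subtractf sum\<rho>)
    qed
    have "(\<Sum>x\<in>P. \<rho> $ x * ln (\<rho> $ x / \<rho> $ x)) = 0"
      using \<rho>pos by (intro sum.neutral) (auto simp: less_le)
    then have val: "(\<Sum>x\<in>P. \<rho> $ x * ln (\<rho> $ x / \<rho> $ x))
       + max 0 (r - (\<Sum>x\<in>P. \<rho> $ x * ln (\<rho> $ x / q0 $ x))) \<le> M + \<epsilon>"
      using D_ge[OF q0(1)] M \<epsilon> by simp
    have "0 < \<rho> $ x \<longleftrightarrow> x \<in> P" for x using \<rho>pos by (auto simp: P_def supp_def)
    then show thesis
      using that[OF \<rho> q0(1)] fair val unfolding P_def by blast
  qed
qed

subsection \<open>Comparison of the exponents\<close>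

lemma renyi_exponent_le_hoeffding_anti:
  assumes "1 < \<alpha>" "supp p \<subseteq> supp q"
  shows "ereal (((\<alpha> - 1) * r - ln (\<Sum>x\<in>supp p. (p $ x) powr \<alpha> * (q $ x) powr (1 - \<alpha>))) / \<alpha>)
    \<le> hoeffding_anti r p q"
proof -
  have "ereal (((\<alpha> - 1) * r - ln (\<Sum>x\<in>supp p. (p $ x) powr \<alpha> * (q $ x) powr (1 - \<alpha>))) / \<alpha>)
    = ereal ((\<alpha> - 1) / \<alpha>) * (ereal r - renyi_div \<alpha> p q)"
    using assms by (simp add: renyi_div_def field_simps)
  also have "\<dots> \<le> hoeffding_anti r p q"
    unfolding hoeffding_anti_def using assms(1) by (intro max.coboundedI2 SUP_upper) auto
  finally show ?thesis .
qed

text \<open>Members of \<open>C\<close> may vanish on the support of \<rho>, so the saddle point is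
  taken over a slightly shrunken copy \<open>K\<close> of \<open>C\<close>. As \<open>K\<close> lies
  in \<open>C\<close>, the Hoeffding bound is inherited; the resulting bet is carried back to
  \<open>C\<close> at a cost that vanishes with \<eta>.\<close>

lemma sc_adv_le_hoeffding_anti_set:
  fixes \<rho> :: "real ^ 'x::finite" and S :: "(real ^ 'x) set"
  assumes \<rho>: "\<rho> \<in> densities" and C: "compact C" "convex C" "C \<subseteq> densities"
    and \<sigma>0: "\<sigma>0 \<in> C" "supp \<rho> \<subseteq> supp \<sigma>0" and r: "0 < r"
  shows "sc_adv r \<rho> C \<le> hoeffding_anti_set r \<rho> C"
proof -
  have "0 \<le> hoeffding_anti r \<rho> \<sigma>0" by (simp add: hoeffding_anti_def)
  also have "\<dots> \<le> hoeffding_anti_set r \<rho> C"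
    unfolding hoeffding_anti_set_def using \<sigma>0 by (intro SUP_upper)
  finally have nonneg: "0 \<le> hoeffding_anti_set r \<rho> C" .
  show ?thesis
  proof (cases "hoeffding_anti_set r \<rho> C")
    case MInf
    then show ?thesis using nonneg by simp
  next
    case (real M)
    then have M: "0 \<le> M" using nonneg by simp
    have nn: "0 \<le> q $ x" if "q \<in> C" for q x using C(3) that by (auto simp: densities_def)
    have step: "sc_adv r \<rho> C \<le> ereal (M + \<epsilon> - ln (1 - \<eta>))" if \<epsilon>: "0 < \<epsilon>" and \<eta>: "0 < \<eta>" "\<eta> < 1" for \<epsilon> \<eta>
    proof -
      text \<open>Mixing with \<open>\<sigma>0\<close> keeps the alternatives bounded away from \<open>0\<close> on the support of \<open>\<rho>\<close>.\<close>
      define mix where "mix q = (1 - \<eta>) *\<^sub>R q + \<eta> *\<^sub>R \<sigma>0" for q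
      define K where "K = mix ` C"
      have K_eq: "K = (\<lambda>q. \<eta> *\<^sub>R \<sigma>0 + q) ` ((\<lambda>q. (1 - \<eta>) *\<^sub>R q) ` C)"
        by (auto simp: K_def mix_def image_image add.commute)
      have KC: "K \<subseteq> C"
        using C(2) \<sigma>0(1) \<eta> by (auto simp: K_def mix_def intro!: convexD)
      have pos: "0 < q $ x" if "q \<in> K" "x \<in> supp \<rho>" for q x
      proof -
        from that obtain q' where q': "q' \<in> C" "q = mix q'" by (auto simp: K_def)
        have "0 < \<sigma>0 $ x" using that(2) \<sigma>0 nn[OF \<sigma>0(1), of x] by (auto simp: supp_def less_le)
        then show ?thesis using q' nn[OF q'(1), of x] \<eta> by (simp add: mix_def add_nonneg_pos)
      qed
      have bound: "((\<alpha> - 1) * r - ln (\<Sum>x\<in>supp \<rho>. (\<rho> $ x) powr \<alpha> * (q $ x) powr (1 - \<alpha>))) / \<alpha> \<le> M"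
        if "q \<in> K" "1 < \<alpha>" for q \<alpha>
      proof -
        have "supp \<rho> \<subseteq> supp q" using pos[OF that(1)] by (force simp: supp_def)
        from renyi_exponent_le_hoeffding_anti[OF that(2) this, of r]
        have "ereal (((\<alpha> - 1) * r - ln (\<Sum>x\<in>supp \<rho>. (\<rho> $ x) powr \<alpha> * (q $ x) powr (1 - \<alpha>))) / \<alpha>)
          \<le> hoeffding_anti r \<rho> q" .
        also have "\<dots> \<le> hoeffding_anti_set r \<rho> C"
          unfolding hoeffding_anti_set_def using that KC by (intro SUP_upper) auto
        finally show ?thesis using real by simp
      qed
      have "compact K"
        unfolding K_eq using C(1) by (intro compact_translation compact_scaling)
      moreover have "convex K"
        unfolding K_eq using C(2) by (intro convex_translation convex_scaling)
      moreover have "K \<noteq> {}" using \<sigma>0(1) by (auto simp: K_def)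
      moreover have "K \<subseteq> densities" using KC C(3) by (rule order_trans)
      ultimately have K: "compact K" "convex K" "K \<noteq> {}" "K \<subseteq> densities" by auto
      obtain \<tau> \<sigma> where \<tau>1: "\<tau> \<in> densities" and \<sigma>: "\<sigma> \<in> K"
        and \<tau>2: "\<forall>x. 0 < \<tau> $ x \<longleftrightarrow> x \<in> supp \<rho>"
        and fair: "\<forall>q\<in>K. (\<Sum>x\<in>supp \<rho>. \<tau> $ x / \<sigma> $ x * q $ x) \<le> 1"
        and val: "(\<Sum>x\<in>supp \<rho>. \<tau> $ x * ln (\<tau> $ x / \<rho> $ x))
         + max 0 (r - (\<Sum>x\<in>supp \<rho>. \<tau> $ x * ln (\<tau> $ x / \<sigma> $ x))) \<le> M + \<epsilon>"
        by (rule saddle_point[OF K \<rho> pos r \<epsilon> M bound])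
      note \<tau> = \<tau>1 \<tau>2[rule_format] and fair = fair[rule_format]
      \<comment> \<open>Because \<open>(1 - \<eta>) * q\<close> lies below \<open>mix q\<close>, the
        factor \<open>1 - \<eta>\<close> makes a bet that is fair on \<open>K\<close> fair on all of
        \<open>C\<close>.\<close>
      define e where "e x = (if x \<in> supp \<rho> then (1 - \<eta>) * (\<tau> $ x / \<sigma> $ x) else 0)" for x
      have \<tau>0: "\<tau> $ x = 0" if "x \<notin> supp \<rho>" for x
      proof -
        have "0 \<le> \<tau> $ x" using \<tau>(1) by (simp add: densities_def)
        then show ?thesis using \<tau>(2)[of x] that by linarith
      qed
      have restrict: "(\<Sum>x\<in>UNIV. \<tau> $ x * g x) = (\<Sum>x\<in>supp \<rho>. \<tau> $ x * g x)" for g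
        by (rule sum.mono_neutral_right) (auto simp: \<tau>0)
      have e_pos: "0 < e x" if "x \<in> supp \<rho>" for x
        using that \<tau>(2) pos[OF \<sigma>] \<eta> by (simp add: e_def)
      have e_nn: "0 \<le> e x" for x using e_pos[of x] by (cases "x \<in> supp \<rho>") (auto simp: e_def)
      have e_fair: "(\<Sum>x\<in>UNIV. q $ x * e x) \<le> 1" if q: "q \<in> C" for q
      proof -
        have "(\<Sum>x\<in>UNIV. q $ x * e x) = (\<Sum>x\<in>supp \<rho>. q $ x * e x)"
          by (rule sum.mono_neutral_right) (auto simp: e_def)
        also have "\<dots> \<le> (\<Sum>x\<in>supp \<rho>. \<tau> $ x / \<sigma> $ x * mix q $ x)"
        proof (rule sum_mono)
          fix x assume x: "x \<in> supp \<rho>"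
          have "0 \<le> \<tau> $ x / \<sigma> $ x" using \<tau>(2)[of x] pos[OF \<sigma> x] x by simp
          moreover have "(1 - \<eta>) * q $ x \<le> mix q $ x"
            using \<eta> nn[OF \<sigma>0(1), of x] by (simp add: mix_def)
          ultimately have "\<tau> $ x / \<sigma> $ x * ((1 - \<eta>) * q $ x) \<le> \<tau> $ x / \<sigma> $ x * mix q $ x"
            by (rule mult_left_mono[rotated])
          then show "q $ x * e x \<le> \<tau> $ x / \<sigma> $ x * mix q $ x"
            using x by (simp add: e_def mult_ac)
        qed
        also have "\<dots> \<le> 1" using q by (intro fair) (auto simp: K_def)
        finally show ?thesis .
      qed
      have "sc_adv r \<rho> C \<le> ereal ((\<Sum>a\<in>UNIV. \<tau> $ a * ln (\<tau> $ a / \<rho> $ a))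
          + max 0 (r - (\<Sum>a\<in>UNIV. \<tau> $ a * ln (e a))))"
      proof (rule sc_adv_le_of_evalue[OF \<rho> \<tau>(1) C(3) _ e_nn e_fair])
        fix a assume "\<tau> $ a \<noteq> 0"
        then have "a \<in> supp \<rho>" using \<tau>0 by auto
        then show "0 < \<rho> $ a \<and> 0 < e a"
          using e_pos \<rho> by (auto simp: supp_def densities_def less_le)
      qed (use \<sigma>0 in auto)
      also have "(\<Sum>a\<in>UNIV. \<tau> $ a * ln (e a)) = ln (1 - \<eta>) + (\<Sum>x\<in>supp \<rho>. \<tau> $ x * ln (\<tau> $ x / \<sigma> $ x))"
      proof -
        have "(\<Sum>a\<in>UNIV. \<tau> $ a * ln (e a)) = (\<Sum>x\<in>supp \<rho>. \<tau> $ x * ln (1 - \<eta>) + \<tau> $ x * ln (\<tau> $ x / \<sigma> $ x))"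
          unfolding restrict
        proof (intro sum.cong refl)
          fix x assume x: "x \<in> supp \<rho>"
          have "0 < \<tau> $ x / \<sigma> $ x" using \<tau>(2) pos[OF \<sigma>] x by simp
          then have "ln (e x) = ln (1 - \<eta>) + ln (\<tau> $ x / \<sigma> $ x)"
            using x \<eta> by (simp add: e_def ln_mult_pos del: times_divide_eq_right)
          then show "\<tau> $ x * ln (e x) = \<tau> $ x * ln (1 - \<eta>) + \<tau> $ x * ln (\<tau> $ x / \<sigma> $ x)"
            by (simp add: distrib_left)
        qed
        also have "\<dots> = ln (1 - \<eta>) + (\<Sum>x\<in>supp \<rho>. \<tau> $ x * ln (\<tau> $ x / \<sigma> $ x))"
          using restrict[of "\<lambda>_. 1"] \<tau>(1)
          by (simp add: sum.distrib densities_def flip: sum_distrib_right)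
        finally show ?thesis .
      qed
      \<comment> \<open>The term \<open>ln (1 - \<eta>)\<close> is not positive, so taking it out of
        the maximum costs at most \<open>- ln (1 - \<eta>)\<close>.\<close>
      also have "(\<Sum>a\<in>UNIV. \<tau> $ a * ln (\<tau> $ a / \<rho> $ a))
          + max 0 (r - (ln (1 - \<eta>) + (\<Sum>x\<in>supp \<rho>. \<tau> $ x * ln (\<tau> $ x / \<sigma> $ x)))) \<le> M + \<epsilon> - ln (1 - \<eta>)"
      proof -
        have "ln (1 - \<eta>) \<le> 0" using \<eta> by simp
        then show ?thesis using val unfolding restrict by linarith
      qed
      finally show ?thesis by simp
    qed
    show ?thesis
    proof (rule ereal_le_epsilon2)
      fix \<epsilon> :: real assume \<epsilon>: "0 < \<epsilon>"
      \<comment> \<open>With \<eta> = \<open>1 - exp (- \<epsilon> / 2)\<close> the loss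
        \<open>- ln (1 - \<eta>)\<close> is exactly \<epsilon> / 2.\<close>
      have "sc_adv r \<rho> C \<le> ereal (M + \<epsilon> / 2 - ln (1 - (1 - exp (- \<epsilon> / 2))))"
        using \<epsilon> by (intro step) auto
      then show "sc_adv r \<rho> C \<le> hoeffding_anti_set r \<rho> C + ereal \<epsilon>"
        using real by (simp add: add.commute)
    qed
  qed simp
qed

text \<open>A larger type II error admits fewer test sequences and so raises the infimum.
  Nonnegativity is demanded because \<open>err_rate\<close> is antitone on nonnegative arguments;
  \<open>n = 0\<close> is exempt because only limits count.\<close>

lemma sc_exp_mono:
  fixes p :: "real ^ 'x::finite" and H H' :: "nat \<Rightarrow> ('x list \<Rightarrow> real) set"
  assumes "\<And>n T. 0 < n \<Longrightarrow> is_test n T \<Longrightarrow>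
     0 \<le> (SUP \<omega>\<in>H n. test_val n \<omega> T) \<and> (SUP \<omega>\<in>H n. test_val n \<omega> T) \<le> (SUP \<omega>\<in>H' n. test_val n \<omega> T)"
  shows "sc_exp r p H \<le> sc_exp r p H'"
  unfolding sc_exp_def
proof (rule Inf_superset_mono, safe, intro exI conjI)
  fix T :: "nat \<Rightarrow> 'x list \<Rightarrow> real"
  assume T: "\<forall>n. is_test n (T n)" and le: "ereal r \<le> liminf (\<lambda>n. err_rate n (SUP \<omega>\<in>H' n. test_val n \<omega> (T n)))"
  note le
  also have "liminf (\<lambda>n. err_rate n (SUP \<omega>\<in>H' n. test_val n \<omega> (T n)))
    \<le> liminf (\<lambda>n. err_rate n (SUP \<omega>\<in>H n. test_val n \<omega> (T n)))"
    using T by (intro Liminf_mono eventually_mono[OF eventually_gt_at_top[of 0]] err_rate_antimono)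
      (auto dest: assms)
  finally show "ereal r \<le> liminf (\<lambda>n. err_rate n (SUP \<omega>\<in>H n. test_val n \<omega> (T n)))" .
qed auto

text \<open>Nonemptiness and normalisation make the real suprema meaningful, and then inclusion
  orders them.\<close>

lemma sc_exp_mono_subset:
  fixes H H' :: "nat \<Rightarrow> ('x::finite list \<Rightarrow> real) set"
  assumes "\<And>n. 0 < n \<Longrightarrow> H n \<noteq> {}" "\<And>n. 0 < n \<Longrightarrow> H n \<subseteq> H' n"
    "\<And>n. H' n \<subseteq> word_densities n"
  shows "sc_exp r p H \<le> sc_exp r p H'"
proof (rule sc_exp_mono, intro conjI)
  fix n and T :: "'x list \<Rightarrow> real" assume "0 < n" "is_test n T"
  then show "0 \<le> (SUP \<omega>\<in>H n. test_val n \<omega> T)"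
    using assms by (intro SUP_test_val_nonneg) blast+
  show "(SUP \<omega>\<in>H n. test_val n \<omega> T) \<le> (SUP \<omega>\<in>H' n. test_val n \<omega> T)"
    using assms \<open>0 < n\<close> \<open>is_test n T\<close> by (intro cSUP_subset_mono bdd_above_test_val) auto
qed

section \<open>Inclusions between the classes of alternatives\<close>

lemma av_hyp_subset_word_densities: "A \<subseteq> densities \<Longrightarrow> av_hyp A n \<subseteq> word_densities n"
  by (auto simp: av_hyp_def intro!: prod_density_in_word_densities)

lemma adv_hyp_subset_word_densities: "adv_hyp A n \<subseteq> word_densities n"
  by (auto simp: adv_hyp_def)

lemma iid_hyp_subset_av_hyp: "iid_hyp A n \<subseteq> av_hyp A n"
  by (auto simp: iid_hyp_def av_hyp_def iid_density_def)

lemma iid_hyp_nonempty: "A \<noteq> {} \<Longrightarrow> iid_hyp A n \<noteq> {}"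
  by (auto simp: iid_hyp_def)

lemma av_hyp_nonempty: "A \<noteq> {} \<Longrightarrow> av_hyp A n \<noteq> {}"
  using iid_hyp_nonempty iid_hyp_subset_av_hyp by (metis subset_empty)

lemma adv_hyp_mono: "A \<subseteq> B \<Longrightarrow> adv_hyp A n \<subseteq> adv_hyp B n"
  by (auto simp: adv_hyp_def)

lemma av_hyp_mono: "A \<subseteq> B \<Longrightarrow> av_hyp A n \<subseteq> av_hyp B n"
  by (auto simp: av_hyp_def)

text \<open>By multilinearity, passing to the closed convex hull leaves the worst type II error of
  every test unchanged.\<close>

lemma sc_av_closure_hull:
  fixes S :: "(real ^ 'x::finite) set"
  assumes "S \<subseteq> densities" "S \<noteq> {}"
  shows "sc_av r p (closure (convex hull S)) = sc_av r p S"
  unfolding sc_av_def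
proof (rule antisym)
  let ?C = "closure (convex hull S)"
  have SC: "S \<subseteq> ?C" by (meson closure_subset hull_subset order_trans)
  have C: "?C \<subseteq> densities" using assms by (intro closure_hull_subset_densities)
  show "sc_exp r p (av_hyp S) \<le> sc_exp r p (av_hyp ?C)"
    using assms SC C by (intro sc_exp_mono_subset av_hyp_nonempty av_hyp_mono av_hyp_subset_word_densities)
  show "sc_exp r p (av_hyp ?C) \<le> sc_exp r p (av_hyp S)"
  proof (rule sc_exp_mono, intro conjI)
    fix n and T :: "'x list \<Rightarrow> real" assume T: "is_test n T"
    have ne: "av_hyp ?C n \<noteq> {}" using SC assms by (intro av_hyp_nonempty) auto
    then show "0 \<le> (SUP \<omega>\<in>av_hyp ?C n. test_val n \<omega> T)"
      using T C by (intro SUP_test_val_nonneg av_hyp_subset_word_densities)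
    show "(SUP \<omega>\<in>av_hyp ?C n. test_val n \<omega> T) \<le> (SUP \<omega>\<in>av_hyp S n. test_val n \<omega> T)"
    proof (rule cSUP_least[OF ne])
      fix \<omega> assume "\<omega> \<in> av_hyp ?C n"
      then obtain q where \<omega>: "\<omega> = prod_density n q" and q: "\<forall>i<n. q i \<in> ?C"
        by (auto simp: av_hyp_def)
      show "test_val n \<omega> T \<le> (SUP \<omega>\<in>av_hyp S n. test_val n \<omega> T)"
        unfolding \<omega>
      proof (rule test_val_prod_density_le_closure_hull[OF _ q])
        fix q assume "\<forall>i<n. q i \<in> S"
        then show "test_val n (prod_density n q) T \<le> (SUP \<omega>\<in>av_hyp S n. test_val n \<omega> T)"
          using T assms
          by (intro cSUP_upper bdd_above_test_val av_hyp_subset_word_densities) (auto simp: av_hyp_def)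
      qed
    qed
  qed
qed

text \<open>Constraining the error against every member of \<open>A\<close> leaves fewer tests than
  constraining it against \<open>q\<close> alone.\<close>

lemma sc_simple_le_sc_relaxed:
  assumes "q \<in> A"
  shows "sc_simple r p q \<le> sc_relaxed r p A"
  unfolding sc_simple_def sc_iid_def sc_exp_def sc_relaxed_def
  using assms by (intro Inf_superset_mono) auto

text \<open>A rate for the supremum over \<open>A\<close> is a rate for each member; the relaxed
  exponent only gives up uniformity.\<close>

lemma sc_relaxed_le_sc_iid:
  fixes p :: "real ^ 'x::finite"
  assumes "A \<subseteq> densities"
  shows "sc_relaxed r p A \<le> sc_iid r p A"
  unfolding sc_relaxed_def sc_iid_def sc_exp_def
proof (rule Inf_superset_mono, safe, intro exI conjI ballI)
  fix T :: "nat \<Rightarrow> 'x list \<Rightarrow> real" and q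
  assume T: "\<forall>n. is_test n (T n)" and q: "q \<in> A"
    and le: "ereal r \<le> liminf (\<lambda>n. err_rate n (SUP \<omega>\<in>iid_hyp A n. test_val n \<omega> (T n)))"
  note le
  also have "liminf (\<lambda>n. err_rate n (SUP \<omega>\<in>iid_hyp A n. test_val n \<omega> (T n)))
    \<le> liminf (\<lambda>n. err_rate n (test_val n (iid_density n q) (T n)))"
  proof (intro Liminf_mono always_eventually allI err_rate_antimono)
    fix n
    show "0 \<le> test_val n (iid_density n q) (T n)"
      using T q assms by (intro iid_test_val_bounds) auto
    have "iid_hyp A n \<subseteq> word_densities n"
      using iid_hyp_subset_av_hyp av_hyp_subset_word_densities[OF assms] by (rule order_trans)
    then show "test_val n (iid_density n q) (T n) \<le> (SUP \<omega>\<in>iid_hyp A n. test_val n \<omega> (T n))"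
      using T q by (intro cSUP_upper bdd_above_test_val) (auto simp: iid_hyp_def)
  qed
  finally show "ereal r \<le> liminf (\<lambda>n. err_rate n (test_val n (iid_density n q) (T n)))" .
qed auto

theorem theoremV22:
  fixes \<rho> :: "real ^ 'x::finite" and S C :: "(real ^ 'x) set" and r :: real
  assumes "\<rho> \<in> densities"
    and "S \<subseteq> densities" and "S \<noteq> {}"
    and "rel_entropy_set \<rho> S < max_div_set \<rho> S"
    and "r > 0"
  defines "C \<equiv> closure (convex hull S)"
  shows "hoeffding_anti_set r \<rho> C = (SUP \<sigma>\<in>C. sc_simple r \<rho> \<sigma>)
    \<and> (SUP \<sigma>\<in>C. sc_simple r \<rho> \<sigma>) \<ge> sc_adv r \<rho> C
    \<and> sc_adv r \<rho> C \<ge> sc_adv r \<rho> S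
    \<and> sc_adv r \<rho> S \<ge> sc_av r \<rho> S
    \<and> sc_av r \<rho> S = sc_av r \<rho> C
    \<and> sc_av r \<rho> C \<ge> sc_iid r \<rho> C
    \<and> sc_iid r \<rho> C \<ge> sc_relaxed r \<rho> C
    \<and> sc_relaxed r \<rho> C \<ge> (SUP \<sigma>\<in>C. sc_simple r \<rho> \<sigma>)
    \<and> (SUP \<sigma>\<in>C. sc_simple r \<rho> \<sigma>) = sc_adv r \<rho> C
    \<and> sc_adv r \<rho> C = sc_adv r \<rho> S
    \<and> sc_adv r \<rho> S = sc_av r \<rho> S
    \<and> sc_av r \<rho> C = sc_iid r \<rho> C
    \<and> sc_iid r \<rho> C = sc_relaxed r \<rho> C
    \<and> sc_relaxed r \<rho> C = (SUP \<sigma>\<in>C. sc_simple r \<rho> \<sigma>)"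
proof -
  have SC: "S \<subseteq> C" unfolding C_def by (meson closure_subset hull_subset order_trans)
  have Cd: "C \<subseteq> densities" unfolding C_def using assms by (intro closure_hull_subset_densities)
  have Cne: "C \<noteq> {}" using SC assms by auto
  have "compact C"
    using bounded_subset[OF bounded_densities Cd] by (simp add: compact_eq_bounded_closed C_def)
  have "convex C" by (simp add: C_def)
  \<comment> \<open>The strict inequality makes D(\<rho>\<parallel>S) finite, so some member of
    \<open>S\<close> dominates \<rho>; it is the density to mix with.\<close>
  have "rel_entropy_set \<rho> S < \<infinity>" using assms(4) by auto
  then obtain \<sigma>0 where "\<sigma>0 \<in> S" "rel_entropy \<rho> \<sigma>0 < \<infinity>"
    unfolding rel_entropy_set_def INF_less_iff by blast
  then have "\<sigma>0 \<in> C" "supp \<rho> \<subseteq> supp \<sigma>0"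
    using SC by (auto simp: rel_entropy_def split: if_splits)
  then have adv_le: "sc_adv r \<rho> C \<le> hoeffding_anti_set r \<rho> C"
    using assms(1,5) \<open>compact C\<close> \<open>convex C\<close> Cd by (intro sc_adv_le_hoeffding_anti_set)
  have hoeffding_le: "hoeffding_anti_set r \<rho> C \<le> (SUP \<sigma>\<in>C. sc_simple r \<rho> \<sigma>)"
    unfolding hoeffding_anti_set_def using assms(1) Cd
    by (intro SUP_mono) (blast intro: hoeffding_anti_le_sc_simple)
  have relaxed: "(SUP \<sigma>\<in>C. sc_simple r \<rho> \<sigma>) \<le> sc_relaxed r \<rho> C"
    by (intro SUP_least sc_simple_le_sc_relaxed)
  have iid: "sc_relaxed r \<rho> C \<le> sc_iid r \<rho> C" using Cd by (rule sc_relaxed_le_sc_iid)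
  have av: "sc_iid r \<rho> C \<le> sc_av r \<rho> C"
    unfolding sc_iid_def sc_av_def using Cd Cne
    by (intro sc_exp_mono_subset iid_hyp_nonempty iid_hyp_subset_av_hyp av_hyp_subset_word_densities)
  have av_eq: "sc_av r \<rho> S = sc_av r \<rho> C"
    unfolding C_def using sc_av_closure_hull assms(2,3) by metis
  have av_adv: "sc_av r \<rho> S \<le> sc_adv r \<rho> S"
    unfolding sc_av_def sc_adv_def using assms(2,3)
    by (intro sc_exp_mono_subset av_hyp_nonempty av_hyp_subset_adv_hyp adv_hyp_subset_word_densities)
  have adv: "sc_adv r \<rho> S \<le> sc_adv r \<rho> C"
    unfolding sc_adv_def using assms(2,3) SC
    by (intro sc_exp_mono_subset adv_hyp_nonempty adv_hyp_mono adv_hyp_subset_word_densities)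
  \<comment> \<open>The inequalities close up to a cycle, which forces equality throughout.\<close>
  show ?thesis
    using adv_le hoeffding_le relaxed iid av av_eq av_adv adv by (auto intro!: antisym)
qed

end
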